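(* Let $f\colon I\to I$ be a tent map of slope $\lambda\in(\sqrt2,2)$ on its dynamical interval $I=[a,b]$, with turning point $c$. Suppose that $f$ is of rational interior type. Write $\kappa=\kappa(f)$ for the kneading sequence of $f$ and $q=m/n=q(\kappa)$ (in lowest terms) for its height. Let $S\in\{0,1\}^{\mathbb Z}$. Then $S\in J_f$ (i.e. $S$ is an itinerary of some point of the inverse limit $\widehat I$) if and only if the following four conditions hold: (a) $\overleftarrow{\sigma^r(S)}\preceq\operatorname{rhe}(q)$ for all $r\in\mathbb Z$; (b) $\overleftarrow{\sigma^r(S)}\preceq\operatorname{lhe}(q)$ for all $r\in\mathbb Z$ for which $\overrightarrow{\sigma^r(S)}\succ\sigma^{n+1}(\kappa)$; (c) $S$ does not end $0^\infty$; and (d) if $c$ is periodic and $\overrightarrow{\sigma^r(S)}=\kappa$ for some $r\in\mathbb Z$, then $S_{r-1}=\varepsilon(f)$.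
   Context: **Tent maps.** $I=[a,b]$ is a compact interval and $f\colon I\to I$ is a (continuous) tent map of slope $\lambda\in(\sqrt2,2)$: there is $c\in(a,b)$ such that $f$ has constant slope $\lambda$ on $[a,c]$ and constant slope $-\lambda$ on $[c,b]$. $I$ is the dynamical interval (core) of $f$: $f(c)=b$ and $f(b)=a$. **Sequences.** $\mathbb N=\{0,1,2,\dots\}$. $\sigma$ denotes the shift map on $\{0,1\}^{\mathbb N}$ and on $\{0,1\}^{\mathbb Z}$: $\sigma(s)_i=s_{i+1}$. For $S\in\{0,1\}^{\mathbb Z}$, define $\overrightarrow S,\overleftarrow S\in\{0,1\}^{\mathbb N}$ by $\overrightarrow S_r=S_r$ and $\overleftarrow S_r=S_{-1-r}$ for $r\ge0$; so $\overrightarrow{\sigma^r(S)}=S_rS_{r+1}\ldots$ and $\overleftarrow{\sigma^r(S)}=S_{r-1}S_{r-2}\ldots$. $S$ *does not end $0^\infty$* if infinitely many entries of $\overrightarrow S$ are $1$. A word is even (odd) if it contains an even (odd) number of $1$s. $W^\infty$ denotes infinite repetition of the word $W$. **Unimodal order.** For distinct $s,t\in\{0,1\}^{\mathbb N}$, $s\prec t$ iff the word $s_0\ldots s_r$ is even, where $r\ge0$ is least with $s_r\ne t_r$. $\preceq$ is the corresponding non-strict order. **Itineraries and kneading sequence.** If $c$ is periodic of period $n$, let $\varepsilon(f)=0$ (resp. $1$) if an even (resp. odd) number of the points $f^r(c)$, $1\le r<n$, lie in $(c,b]$ (here $n$ is the period of $c$, not the denominator of $q$); the itinerary $j(x)\in\{0,1\}^{\mathbb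 N}$ of $x\in I$ has $j(x)_r=0$, $1$, or $\varepsilon(f)$ according as $f^r(x)\in[a,c)$, $f^r(x)\in(c,b]$, or $f^r(x)=c$; and $\kappa(f)=j(b)$. If $c$ is not periodic, $s\in\{0,1\}^{\mathbb N}$ is an itinerary of $x\in I$ if $f^r(x)\in[a,c]$ whenever $s_r=0$ and $f^r(x)\in[c,b]$ whenever $s_r=1$; and $\kappa(f)$ is the (unique) itinerary of $b$. **Inverse limit.** $\widehat I=\{\mathbf x\in I^{\mathbb Z}: f(x_r)=x_{r+1}\text{ for all }r\in\mathbb Z\}$. If $c$ is periodic, the unique itinerary $J(\mathbf x)\in\{0,1\}^{\mathbb Z}$ of $\mathbf x\in\widehat I$ has $J(\mathbf x)_r=0$, $1$, or $\varepsilon(f)$ according as $x_r\in[a,c)$, $x_r\in(c,b]$, or $x_r=c$. If $c$ is not periodic, $S\in\{0,1\}^{\mathbb Z}$ is an itinerary of $\mathbf x$ if $x_r\in[a,c]$ whenever $S_r=0$ and $x_r\in[c,b]$ whenever $S_r=1$. $J_f\subset\{0,1\}^{\mathbb Z}$ is the set of all itineraries of points of $\widehat I$. **Height.** All rationals $m/n$ are in lowest terms. For $q\in(0,1/2]$ and $i\ge1$, let $k_i(q)$ be two less than the number of vertical lines $x=\text{integer}$ in $\mathbb R^2$ which the line $y=qx$ intersects for $y\in[i-1,i]$. If $q=m/n$ is rational, let $c_q=10^{k_1(q)}110^{k_2(q)}11\ldots110^{k_m(q)}1\in\{0,1\}^{n+1}$. The height of $s\in\{0,1\}^{\mathbb N}$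 is $q(s)=\inf\left(\{q\in(0,1/2]\cap\mathbb Q:(c_q0)^\infty\prec s\}\cup\{1/2\}\right)\in[0,1/2]$. The condition $\lambda\in(\sqrt2,2)$ is equivalent to $q(\kappa(f))\in(0,1/2)$. For rational $q=m/n\in(0,1/2)$, let $w_q\in\{0,1\}^{n-1}$ consist of the first $n-1$ symbols of $c_q$ (so $c_q=w_q01$), let $\widehat w_q$ be the reverse of $w_q$, and set $\operatorname{lhe}(q)=(w_q1)^\infty$, $\operatorname{rhe}(q)=c_q(1\widehat w_q)^\infty$. **Types.** $f$ is of *rational interior type* if $q=q(\kappa(f))$ is rational and $\kappa(f)$ is not equal to $\operatorname{lhe}(q')$ or $\operatorname{rhe}(q')$ for any rational $q'\in(0,1/2)$. *)

theory Defs
  imports "HOL-Analysis.Analysis" "HOL-Library.Z2" "HOL-Library.Omega_Words_Fun"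
begin

text \<open>
  Sequences over \<open>{0,1}\<close> have type \<^typ>\<open>bit word\<close> (that is, \<^typ>\<open>nat \<Rightarrow> bit\<close>) or
  \<^typ>\<open>int \<Rightarrow> bit\<close>. Of the library's operations on infinite words, \<^term>\<open>suffix n s\<close> is the
  \<open>n\<close>-fold shift of \<open>s\<close>, \<^term>\<open>u \<frown> s\<close> is concatenation, and \<^term>\<open>u\<^sup>\<omega>\<close> is infinite repetition.
  The field structure of \<^typ>\<open>bit\<close> plays no role.
\<close>

section \<open>Symbol sequences\<close>

definition bishift :: "int \<Rightarrow> (int \<Rightarrow> bit) \<Rightarrow> (int \<Rightarrow> bit)" where
  "bishift r S = (\<lambda>i. S (i + r))"

definition fwd :: "(int \<Rightarrow> bit) \<Rightarrow> bit word" where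
  "fwd S = (\<lambda>r. S (int r))"

definition bwd :: "(int \<Rightarrow> bit) \<Rightarrow> bit word" where
  "bwd S = (\<lambda>r. S (- 1 - int r))"

definition ends_zeros :: "(int \<Rightarrow> bit) \<Rightarrow> bool" where
  "ends_zeros S \<longleftrightarrow> finite {r. fwd S r = 1}"

definition even_word :: "bit list \<Rightarrow> bool" where
  "even_word u \<longleftrightarrow> even (count_list u 1)"

definition uni_less :: "bit word \<Rightarrow> bit word \<Rightarrow> bool" (infix "\<prec>\<^sub>u" 50) where
  "s \<prec>\<^sub>u t \<longleftrightarrow> s \<noteq> t \<and> even_word (prefix (Suc (LEAST r. s r \<noteq> t r)) s)"

definition uni_le :: "bit word \<Rightarrow> bit word \<Rightarrow> bool" (infix "\<preceq>\<^sub>u" 50) where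
  "s \<preceq>\<^sub>u t \<longleftrightarrow> s \<prec>\<^sub>u t \<or> s = t"

section \<open>Height\<close>

definition run_length :: "real \<Rightarrow> nat \<Rightarrow> nat" where
  "run_length q i = card {x::int. \<exists>y\<in>{real i - 1..real i}. y = q * of_int x} - 2"

definition rat_num :: "rat \<Rightarrow> nat" where
  "rat_num q = nat (fst (quotient_of q))"

definition rat_den :: "rat \<Rightarrow> nat" where
  "rat_den q = nat (snd (quotient_of q))"

text \<open>
  With \<open>k\<^sub>i = run_length q i\<close> and \<open>q = m/n\<close>, the word \<open>1 0^k\<^sub>1 11 0^k\<^sub>2 11 \<dots> 11 0^k\<^sub>m 1\<close> is the
  concatenation of the blocks \<open>1 0^k\<^sub>i 1\<close> for \<open>i = 1, \<dots>, m\<close>.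
\<close>

definition c_word :: "rat \<Rightarrow> bit list" where
  "c_word q = concat (map (\<lambda>i. [1] @ replicate (run_length (of_rat q) i) 0 @ [1]) [1..<rat_num q + 1])"

definition w_word :: "rat \<Rightarrow> bit list" where
  "w_word q = take (rat_den q - 1) (c_word q)"

definition height :: "bit word \<Rightarrow> real" where
  "height s = Inf ({of_rat q | q::rat. 0 < q \<and> q \<le> 1/2 \<and> (c_word q @ [0])\<^sup>\<omega> \<prec>\<^sub>u s} \<union> {1/2})"

definition lhe :: "rat \<Rightarrow> bit word" where
  "lhe q = (w_word q @ [1])\<^sup>\<omega>"

definition rhe :: "rat \<Rightarrow> bit word" where
  "rhe q = c_word q \<frown> (1 # rev (w_word q))\<^sup>\<omega>"

section \<open>Tent maps, itineraries and the kneading sequence\<close>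

text \<open>
  The map \<open>f\<close> is a total function on the reals, but only its values on \<open>[a,b]\<close> are constrained
  and used.
\<close>

definition tent_map :: "(real \<Rightarrow> real) \<Rightarrow> real \<Rightarrow> real \<Rightarrow> real \<Rightarrow> real \<Rightarrow> bool" where
  "tent_map f a b c l \<longleftrightarrow>
     a < c \<and> c < b \<and> continuous_on {a..b} f \<and> f ` {a..b} \<subseteq> {a..b} \<and>
     (\<forall>x\<in>{a..c}. \<forall>y\<in>{a..c}. f y - f x = l * (y - x)) \<and>
     (\<forall>x\<in>{c..b}. \<forall>y\<in>{c..b}. f y - f x = - l * (y - x)) \<and>
     f c = b \<and> f b = a"

definition periodic_point :: "('a \<Rightarrow> 'a) \<Rightarrow> 'a \<Rightarrow> bool" where
  "periodic_point f x \<longleftrightarrow> (\<exists>p>0. (f ^^ p) x = x)"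

definition least_period :: "('a \<Rightarrow> 'a) \<Rightarrow> 'a \<Rightarrow> nat" where
  "least_period f x = (LEAST p. p > 0 \<and> (f ^^ p) x = x)"

definition eps :: "(real \<Rightarrow> real) \<Rightarrow> real \<Rightarrow> real \<Rightarrow> bit" where
  "eps f b c =
     (if even (card {r. 1 \<le> r \<and> r < least_period f c \<and> (f ^^ r) c \<in> {c<..b}}) then 0 else 1)"

text \<open>
  \<open>admissible_symbol f a b c x s\<close>: the symbol \<open>s\<close> may occur in an itinerary at a time when the
  orbit is at \<open>x \<in> [a,b]\<close>. When \<open>c\<close> is periodic there is exactly one such symbol; otherwise both
  symbols are allowed at \<open>c\<close>.
\<close>

definition admissible_symbol ::
    "(real \<Rightarrow> real) \<Rightarrow> real \<Rightarrow> real \<Rightarrow> real \<Rightarrow> real \<Rightarrow> bit \<Rightarrow> bool" where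
  "admissible_symbol f a b c x s \<longleftrightarrow>
     (if periodic_point f c
      then (x \<in> {a..<c} \<longrightarrow> s = 0) \<and> (x \<in> {c<..b} \<longrightarrow> s = 1) \<and> (x = c \<longrightarrow> s = eps f b c)
      else (s = 0 \<longrightarrow> x \<in> {a..c}) \<and> (s = 1 \<longrightarrow> x \<in> {c..b}))"

definition is_itinerary ::
    "(real \<Rightarrow> real) \<Rightarrow> real \<Rightarrow> real \<Rightarrow> real \<Rightarrow> real \<Rightarrow> bit word \<Rightarrow> bool" where
  "is_itinerary f a b c x s \<longleftrightarrow> (\<forall>r. admissible_symbol f a b c ((f ^^ r) x) (s r))"

definition kneading :: "(real \<Rightarrow> real) \<Rightarrow> real \<Rightarrow> real \<Rightarrow> real \<Rightarrow> bit word" where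
  "kneading f a b c = (THE s. is_itinerary f a b c b s)"

definition inverse_limit :: "(real \<Rightarrow> real) \<Rightarrow> real \<Rightarrow> real \<Rightarrow> (int \<Rightarrow> real) set" where
  "inverse_limit f a b = {x. \<forall>r. x r \<in> {a..b} \<and> f (x r) = x (r + 1)}"

definition inverse_limit_itineraries ::
    "(real \<Rightarrow> real) \<Rightarrow> real \<Rightarrow> real \<Rightarrow> real \<Rightarrow> (int \<Rightarrow> bit) set" where
  "inverse_limit_itineraries f a b c =
     {S. \<exists>x\<in>inverse_limit f a b. \<forall>r. admissible_symbol f a b c (x r) (S r)}"

definition rational_interior_type :: "(real \<Rightarrow> real) \<Rightarrow> real \<Rightarrow> real \<Rightarrow> real \<Rightarrow> bool" where
  "rational_interior_type f a b c \<longleftrightarrow>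
     height (kneading f a b c) \<in> \<rat> \<and>
     (\<forall>q'::rat. 0 < q' \<and> q' < 1/2 \<longrightarrow>
        kneading f a b c \<noteq> lhe q' \<and> kneading f a b c \<noteq> rhe q')"

end

theory Submission
  imports Defs
begin

text \<open>
  Write \<open>B(k) = 1 0^k 1\<close>. Then \<open>rhe q = B(e\<^sub>0) B(e\<^sub>1) \<dots>\<close> and \<open>lhe q = B(l\<^sub>0) B(l\<^sub>1) \<dots>\<close>, where the
  first \<open>i \<ge> 1\<close> blocks have total length \<open>\<lfloor>i/q\<rfloor> + 1\<close> and \<open>\<lceil>i/q\<rceil>\<close>, respectively, and the block
  expansions are ordered like the sequences of exponents. Total length is invariant under
  reversal, and \<open>i \<mapsto> \<lfloor>i/q\<rfloor>\<close> is superadditive; hence, up to tails \<open>0^\<infinity>\<close>, all forward sequences of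
  \<open>S\<close> are at most \<open>rhe q\<close> if and only if all backward ones are. Since \<open>q\<close> is the height of \<open>\<kappa>\<close>, we have
  \<open>lhe q \<prec> \<kappa> \<prec> rhe q\<close>, and maximality of \<open>\<kappa>\<close> among its shifts gives \<open>\<kappa> = c\<^sub>q y\<close>. A forward sequence
  between \<open>\<kappa>\<close> and \<open>rhe q\<close> is then \<open>c\<^sub>q t\<close> with \<open>t \<succ> y\<close>, and as \<open>c\<^sub>q\<close> is a palindrome this is what
  the second condition forbids.

  On the dynamical side, \<open>S\<close> is an itinerary if and only if all its forward sequences are at most
  \<open>\<kappa>\<close>, up to sequences ending in \<open>0^\<infinity>\<close> on either side and the convention for the symbol at \<open>c\<close>.
  The point with itinerary \<open>s\<close> is the value of a geometric series. For \<open>s\<close> whose shifts are at most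
  \<open>\<kappa>\<close>, comparing it with \<open>\<kappa>\<close> at the first difference contracts its excess over \<open>b\<close> by the
  factor \<open>1/l\<close>, so there is no excess.
\<close>

section \<open>The unimodal order\<close>

text \<open>Relational substitute for the \<open>LEAST\<close> in \<open>uni_less_def\<close>; the
  same witness \<open>r\<close> serves both orientations of a comparison.\<close>

definition first_diff :: "nat \<Rightarrow> 'a word \<Rightarrow> 'a word \<Rightarrow> bool" where
  "first_diff r s t \<longleftrightarrow> (\<forall>i<r. s i = t i) \<and> s r \<noteq> t r"

lemma first_diff_exists:
  assumes "s \<noteq> t"
  obtains r where "first_diff r s t"
proof -
  from assms obtain r0 where "s r0 \<noteq> t r0" by auto
  then have "first_diff (LEAST r. s r \<noteq> t r) s t"
    unfolding first_diff_def by (metis (mono_tags, lifting) LeastI not_less_Least)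
  then show ?thesis using that by blast
qed

lemma first_diff_Least: "first_diff r s t \<Longrightarrow> (LEAST r. s r \<noteq> t r) = r"
  unfolding first_diff_def by (intro Least_equality) (auto simp: not_less[symmetric])

lemma first_diff_sym: "first_diff r s t \<Longrightarrow> first_diff r t s"
  unfolding first_diff_def by metis

lemma first_diff_prefix: "first_diff r s t \<Longrightarrow> prefix r s = prefix r t"
  unfolding first_diff_def subsequence_def by auto

lemma prefix_eq_iff: "prefix r s = prefix r t \<longleftrightarrow> (\<forall>i<r. s i = t i)"
  unfolding subsequence_def by auto

lemma even_word_simps [simp]:
  "even_word []"
  "even_word (0 # u) = even_word u"
  "even_word (1 # u) \<longleftrightarrow> \<not> even_word u"
  "even_word (u @ v) \<longleftrightarrow> (even_word u \<longleftrightarrow> even_word v)"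
  "even_word (replicate k 0)"
  by (auto simp: even_word_def)

lemma even_word_rev [simp]: "even_word (rev u) = even_word u"
  by (simp add: even_word_def)

lemma prefix_Suc: "prefix (Suc r) s = prefix r s @ [s r]"
  by simp

lemma uni_less_iff: "s \<prec>\<^sub>u t \<longleftrightarrow> (\<exists>r. first_diff r s t \<and> even_word (prefix (Suc r) s))"
proof
  assume *: "s \<prec>\<^sub>u t"
  then obtain r where "first_diff r s t" using first_diff_exists uni_less_def by metis
  with * show "\<exists>r. first_diff r s t \<and> even_word (prefix (Suc r) s)"
    by (auto simp: uni_less_def first_diff_Least)
next
  assume "\<exists>r. first_diff r s t \<and> even_word (prefix (Suc r) s)"
  then obtain r where "first_diff r s t" "even_word (prefix (Suc r) s)" by blast
  then show "s \<prec>\<^sub>u t" by (auto simp: uni_less_def first_diff_Least) (auto simp: first_diff_def)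
qed

lemma first_diff_unique: "first_diff r s t \<Longrightarrow> first_diff r' s t \<Longrightarrow> r = r'"
  by (metis first_diff_Least)

text \<open>The two prefixes differ only in their last symbol, which changes the parity. Asymmetry,
  totality and transitivity of the order rest on this.\<close>

lemma even_word_prefix_first_diff:
  assumes "first_diff r s t"
  shows "even_word (prefix (Suc r) t) \<longleftrightarrow> \<not> even_word (prefix (Suc r) s)"
proof -
  have "s r \<noteq> t r" using assms by (simp add: first_diff_def)
  then show ?thesis using first_diff_prefix[OF assms]
    by (cases "s r"; cases "t r"; simp add: prefix_Suc del: subseq_to_Suc)
qed

lemma uni_less_first_diff: "first_diff r s t \<Longrightarrow> s \<prec>\<^sub>u t \<longleftrightarrow> even_word (prefix (Suc r) s)"
  using uni_less_iff first_diff_unique by blast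

lemma uni_less_linear: "s \<prec>\<^sub>u t \<or> s = t \<or> t \<prec>\<^sub>u s"
proof (cases "s = t")
  case False
  then obtain r where r: "first_diff r s t" using first_diff_exists by blast
  show ?thesis using uni_less_first_diff[OF r] uni_less_first_diff[OF first_diff_sym[OF r]]
      even_word_prefix_first_diff[OF r] by blast
qed simp

lemma uni_less_irrefl [simp]: "\<not> s \<prec>\<^sub>u s"
  by (simp add: uni_less_def)

lemma uni_less_asym: "s \<prec>\<^sub>u t \<Longrightarrow> \<not> t \<prec>\<^sub>u s"
  unfolding uni_less_iff
  using even_word_prefix_first_diff first_diff_sym first_diff_unique by metis

lemma uni_less_trans:
  assumes "s \<prec>\<^sub>u t" "t \<prec>\<^sub>u u"
  shows "s \<prec>\<^sub>u u"
proof -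
  obtain r where r: "first_diff r s t" "even_word (prefix (Suc r) s)"
    using assms(1) uni_less_iff by blast
  obtain r' where r': "first_diff r' t u" "even_word (prefix (Suc r') t)"
    using assms(2) uni_less_iff by blast
  consider "r < r'" | "r' < r" | "r = r'" by linarith
  then show ?thesis
  proof cases
    case 1
    then have "first_diff r s u" using r(1) r'(1) by (simp add: first_diff_def)
    then show ?thesis using r(2) uni_less_iff by blast
  next
    case 2
    then have "first_diff r' s u" using r(1) r'(1) by (simp add: first_diff_def)
    moreover have "prefix (Suc r') s = prefix (Suc r') t"
      using 2 r(1) unfolding prefix_eq_iff by (simp add: first_diff_def)
    ultimately show ?thesis using r'(2) uni_less_iff by metis
  next
    case 3
    \<comment> \<open>This case cannot occur: the prefix of \<open>t\<close> would be odd by the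
      first comparison and even by the second.\<close>
    then show ?thesis using r r' even_word_prefix_first_diff by blast
  qed
qed

lemma uni_le_less_trans: "s \<preceq>\<^sub>u t \<Longrightarrow> t \<prec>\<^sub>u u \<Longrightarrow> s \<prec>\<^sub>u u"
  and uni_less_le_trans: "s \<prec>\<^sub>u t \<Longrightarrow> t \<preceq>\<^sub>u u \<Longrightarrow> s \<prec>\<^sub>u u"
  by (auto simp: uni_le_def intro: uni_less_trans)

lemma not_uni_less_iff: "\<not> s \<prec>\<^sub>u t \<longleftrightarrow> t \<preceq>\<^sub>u s"
  using uni_less_linear uni_less_asym uni_le_def uni_less_irrefl by metis

lemma not_uni_le_iff: "\<not> s \<preceq>\<^sub>u t \<longleftrightarrow> t \<prec>\<^sub>u s"
  using not_uni_less_iff by blast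

section \<open>Common prefixes and cylinder sets\<close>

lemma first_diff_conc:
  "first_diff r s t \<Longrightarrow> first_diff (length u + r) (u \<frown> s) (u \<frown> t)"
  by (auto simp: first_diff_def conc_def)

lemma uni_less_conc:
  "(u \<frown> s) \<prec>\<^sub>u (u \<frown> t) \<longleftrightarrow> (if even_word u then s \<prec>\<^sub>u t else t \<prec>\<^sub>u s)"
proof (cases "s = t")
  case False
  then obtain r where r: "first_diff r s t" using first_diff_exists by blast
  have "prefix (Suc (length u + r)) (u \<frown> s) = u @ prefix (Suc r) s"
    by (subst prefix_conc_snd) (auto simp del: subseq_to_Suc simp: Suc_diff_le)
  then show ?thesis
    using uni_less_first_diff[OF first_diff_conc[OF r, of u]] uni_less_first_diff[OF r]
      uni_less_first_diff[OF first_diff_sym[OF r]] even_word_prefix_first_diff[OF r] by auto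
qed auto

lemma uni_le_conc_even: "even_word u \<Longrightarrow> (u \<frown> s) \<preceq>\<^sub>u (u \<frown> t) \<longleftrightarrow> s \<preceq>\<^sub>u t"
  by (simp add: uni_le_def uni_less_conc)

lemma uni_less_build [simp]:
  "(0 ## s) \<prec>\<^sub>u (1 ## t)" "\<not> (1 ## s) \<prec>\<^sub>u (0 ## t)"
  "(0 ## s) \<prec>\<^sub>u (0 ## t) \<longleftrightarrow> s \<prec>\<^sub>u t"
  "(1 ## s) \<prec>\<^sub>u (1 ## t) \<longleftrightarrow> t \<prec>\<^sub>u s"
proof -
  have "first_diff 0 (0 ## s) (1 ## t)" by (simp add: first_diff_def)
  from uni_less_first_diff[OF this] show "(0 ## s) \<prec>\<^sub>u (1 ## t)"
    by (simp add: even_word_def)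
  have *: "(0 ## t) \<prec>\<^sub>u (1 ## s)"
    using uni_less_first_diff[of 0 "0 ## t" "1 ## s"] by (simp add: even_word_def first_diff_def)
  show "\<not> (1 ## s) \<prec>\<^sub>u (0 ## t)" using * uni_less_asym by blast
  show "(0 ## s) \<prec>\<^sub>u (0 ## t) \<longleftrightarrow> s \<prec>\<^sub>u t" using uni_less_conc[of "[0]" s t] by simp
  show "(1 ## s) \<prec>\<^sub>u (1 ## t) \<longleftrightarrow> t \<prec>\<^sub>u s" using uni_less_conc[of "[1]" s t] by simp
qed

lemma conc_prefixI: "prefix (length u) s = u \<Longrightarrow> \<exists>s'. s = u \<frown> s'"
  by (metis prefix_suffix)

lemma first_diff_conc_not_prefix:
  assumes "first_diff r s (u \<frown> p)" "prefix (length u) s \<noteq> u"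
  shows "r < length u" "first_diff r s (u \<frown> p')"
proof -
  show *: "r < length u"
  proof (rule ccontr)
    assume "\<not> r < length u"
    then have "prefix (length u) s = prefix (length u) (u \<frown> p)"
      using assms(1) unfolding prefix_eq_iff first_diff_def by simp
    then show False using assms(2) by simp
  qed
  show "first_diff r s (u \<frown> p')"
    using assms(1) * by (simp add: first_diff_def)
qed

text \<open>The first difference lies inside \<open>u\<close>, so what follows \<open>u\<close> has
  no influence.\<close>

lemma uni_less_not_prefix:
  assumes "s \<prec>\<^sub>u (u \<frown> p)" "\<nexists>s'. s = u \<frown> s'"
  shows "s \<prec>\<^sub>u (u \<frown> p')"
  using assms first_diff_conc_not_prefix conc_prefixI unfolding uni_less_iff by metis

lemma uni_greater_not_prefix:
  assumes "(u \<frown> p) \<prec>\<^sub>u s" "\<nexists>s'. s = u \<frown> s'"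
  shows "(u \<frown> p') \<prec>\<^sub>u s"
proof -
  have "s \<noteq> u \<frown> p'" "\<not> s \<prec>\<^sub>u (u \<frown> p')"
    using assms uni_less_not_prefix uni_less_asym by blast+
  then show ?thesis using uni_less_linear by blast
qed

text \<open>Cylinder sets are convex: a sequence outside the cylinder of \<open>u\<close> compares
  in the same way with all its members.\<close>

lemma uni_less_between_prefix:
  assumes "(u \<frown> p) \<preceq>\<^sub>u s" "s \<preceq>\<^sub>u (u \<frown> p')"
  obtains s' where "s = u \<frown> s'"
proof -
  have "\<exists>s'. s = u \<frown> s'"
  proof (rule ccontr)
    assume n: "\<nexists>s'. s = u \<frown> s'"
    then have "s \<prec>\<^sub>u (u \<frown> p')" using assms(2) by (auto simp: uni_le_def)
    then have "s \<prec>\<^sub>u (u \<frown> p)" using n uni_less_not_prefix by blast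
    then show False using assms(1) not_uni_less_iff by blast
  qed
  then show ?thesis using that by blast
qed

section \<open>Block words\<close>

definition block :: "nat \<Rightarrow> bit list" where
  "block k = 1 # replicate k 0 @ [1]"

definition block_word :: "nat list \<Rightarrow> bit list" where
  "block_word ks = concat (map block ks)"

text \<open>\<open>t\<close> is the infinite concatenation of blocks with exponents
  \<open>e 0\<close>, \<open>e 1\<close>, ..., expressed through its finite initial parts.\<close>

definition has_blocks :: "(nat \<Rightarrow> nat) \<Rightarrow> bit word \<Rightarrow> bool" where
  "has_blocks e t \<longleftrightarrow> (\<forall>i. \<exists>t'. t = block_word (map e [0..<i]) \<frown> t')"

lemma block_word_simps [simp]:
  "block_word [] = []"
  "block_word (k # ks) = block k @ block_word ks"
  "block_word (ks @ ks') = block_word ks @ block_word ks'"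
  by (simp_all add: block_word_def)

lemma rev_block [simp]: "rev (block k) = block k"
  by (simp add: block_def)

lemma rev_block_word: "rev (block_word ks) = block_word (rev ks)"
  by (induction ks) simp_all

lemma length_block [simp]: "length (block k) = k + 2"
  by (simp add: block_def)

lemma even_word_block [simp]: "even_word (block k)"
  by (simp add: block_def)

lemma even_word_block_word [simp]: "even_word (block_word ks)"
  by (induction ks) auto

lemma length_block_word: "length (block_word ks) = (\<Sum>k\<leftarrow>ks. k + 2)"
  by (induction ks) auto

section \<open>Comparing blocks and block expansions\<close>

lemma uni_less_zeros:
  assumes "k < k'"
  shows "(replicate k' 0 \<frown> s) \<prec>\<^sub>u (replicate k 0 \<frown> (1 ## t))"
proof -
  have "replicate k' (0::bit) = replicate k 0 @ 0 # replicate (k' - Suc k) 0"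
    using assms by (simp flip: replicate_Suc replicate_add)
  then show ?thesis by (simp add: uni_less_conc del: conc_conc)
qed

text \<open>The leading 1 reverses the order, so the longer run of zeros is larger. That run need
  not be closed by a 1.\<close>

lemma block_less:
  assumes "k < k'"
  shows "(block k \<frown> t) \<prec>\<^sub>u (1 ## (replicate k' 0 \<frown> s))"
  using uni_less_zeros[OF assms, of s t] by (simp add: block_def)

lemma block_less_block: "k < k' \<Longrightarrow> (block k \<frown> t) \<prec>\<^sub>u (block k' \<frown> s)"
  using block_less[of k k' t "1 ## s"] by (simp add: block_def)

text \<open>After the leading 1 the order is reversed, so the rest of \<open>s\<close> lies below
  0^k 1... . A 1 among its first \<open>k\<close> symbols would put it above; hence it begins with
  0^k, and the next symbol is not 1.\<close>

lemma greater_block_zeros: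
  assumes less: "(block k \<frown> t) \<prec>\<^sub>u s" and no: "\<nexists>s'. s = block k \<frown> s'"
  obtains s' where "s = 1 ## (replicate (Suc k) 0 \<frown> s')"
proof -
  have s0: "s 0 = 1"
  proof (rule ccontr)
    assume "s 0 \<noteq> 1"
    then have "s = 0 ## suffix 1 s" using build_split[of s] by simp
    then show False using less by (metis append_Cons block_def build_cons uni_less_build(2))
  qed
  define s1 where "s1 = suffix 1 s"
  have s: "s = 1 ## s1" using build_split[of s] s0 s1_def by simp
  have less1: "s1 \<prec>\<^sub>u (replicate k 0 \<frown> (1 ## t))" using less unfolding s by (simp add: block_def)
  have "s1 \<prec>\<^sub>u (replicate k 0 \<frown> (1 ## t)) \<Longrightarrow> \<nexists>s'. s1 = replicate k 0 \<frown> (1 ## s')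
       \<Longrightarrow> \<exists>s'. s1 = replicate (Suc k) 0 \<frown> s'" for k
  proof (induction k arbitrary: s1)
    case 0
    have s1: "s1 = s1 0 ## suffix 1 s1" by (rule build_split)
    then have "s1 0 \<noteq> 1" using 0(2) by (metis conc_empty replicate_0)
    then have "s1 = 0 ## suffix 1 s1" using s1 by simp
    then show ?case by (metis build_cons conc_empty replicate_0 replicate_Suc)
  next
    case (Suc k)
    have s1: "s1 = s1 0 ## suffix 1 s1" by (rule build_split)
    have "s1 0 = 0"
    proof (rule ccontr)
      assume "s1 0 \<noteq> 0"
      then have "s1 = 1 ## suffix 1 s1" using s1 by simp
      then show False using Suc.prems(1) by (metis build_cons replicate_Suc uni_less_build(2))
    qed
    then have s1': "s1 = 0 ## suffix 1 s1" using s1 by simp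
    have "suffix 1 s1 \<prec>\<^sub>u (replicate k 0 \<frown> (1 ## t))"
      using Suc.prems(1) s1' by (metis build_cons replicate_Suc uni_less_build(3))
    moreover have "\<nexists>s'. suffix 1 s1 = replicate k 0 \<frown> (1 ## s')"
      using Suc.prems(2) s1' by (metis build_cons replicate_Suc)
    ultimately obtain s' where "suffix 1 s1 = replicate (Suc k) 0 \<frown> s'" using Suc.IH by blast
    then show ?case using s1' by (metis build_cons replicate_Suc)
  qed
  moreover have "\<nexists>s'. s1 = replicate k 0 \<frown> (1 ## s')" using no s by (auto simp: block_def)
  ultimately show ?thesis using less1 that s by blast
qed

lemma has_blocks_suffix:
  assumes "has_blocks e t"
  obtains t' where "t = block_word (map e [0..<i]) \<frown> (block (e i) \<frown> t')"
proof -
  obtain t' where "t = block_word (map e [0..<Suc i]) \<frown> t'"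
    using assms by (auto simp: has_blocks_def simp del: upt_Suc)
  then show ?thesis using that[of t'] by simp
qed

lemma conc_arbitrarily_long_unique:
  assumes "\<And>i. \<exists>u x y. length u \<ge> i \<and> s = u \<frown> x \<and> t = u \<frown> y"
  shows "s = t"
proof
  fix i
  obtain u x y where "length u \<ge> Suc i" "s = u \<frown> x" "t = u \<frown> y" using assms by blast
  then show "s i = t i" by simp
qed

text \<open>Block version of \<open>first_diff\<close>: \<open>i\<close> counts the complete blocks
  shared with \<open>t\<close>. Sharing every number of blocks would force
  \<open>s = t\<close>.\<close>

lemma has_blocks_first_diff:
  assumes "has_blocks e t" "s \<noteq> t"
  obtains i s' where "s = block_word (map e [0..<i]) \<frown> s'" "\<nexists>s''. s' = block (e i) \<frown> s''"
proof -
  let ?P = "\<lambda>i. \<exists>s'. s = block_word (map e [0..<i]) \<frown> s'"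
  have "\<not> (\<forall>i. ?P i)"
  proof
    assume all: "\<forall>i. ?P i"
    have "length (block_word (map e [0..<i])) \<ge> i" for i
      by (induction i) auto
    then have "s = t" using assms(1) all unfolding has_blocks_def
      by (intro conc_arbitrarily_long_unique) meson
    then show False using assms(2) by simp
  qed
  moreover have "?P 0" by simp
  ultimately obtain i where "?P i" "\<not> ?P (Suc i)" using nat_induct[of ?P] by blast
  then show ?thesis using that[of i] by fastforce
qed

text \<open>Block words are even, so the comparison passes to the remainder \<open>s'\<close>. As
  \<open>s'\<close> does not begin with the next block, the continuation \<open>x\<close> of that
  block is arbitrary.\<close>

lemma greater_has_blocks:
  assumes "has_blocks e t" "t \<prec>\<^sub>u s"
  obtains i s' where "s = block_word (map e [0..<i]) \<frown> s'" "\<And>x. (block (e i) \<frown> x) \<prec>\<^sub>u s'"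
    "\<nexists>s''. s' = block (e i) \<frown> s''"
proof -
  have "s \<noteq> t" using assms(2) by auto
  then obtain i s' where s: "s = block_word (map e [0..<i]) \<frown> s'" "\<nexists>s''. s' = block (e i) \<frown> s''"
    using has_blocks_first_diff assms(1) by blast
  obtain t' where "t = block_word (map e [0..<i]) \<frown> (block (e i) \<frown> t')"
    using has_blocks_suffix assms(1) by blast
  then have "(block (e i) \<frown> t') \<prec>\<^sub>u s'" using assms(2) s by (simp add: uni_less_conc del: conc_conc)
  then show ?thesis using that s uni_greater_not_prefix by blast
qed

lemma less_has_blocks:
  assumes "has_blocks e t" "s \<prec>\<^sub>u t"
  obtains i s' where "s = block_word (map e [0..<i]) \<frown> s'" "\<And>x. s' \<prec>\<^sub>u (block (e i) \<frown> x)"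
proof -
  have "s \<noteq> t" using assms(2) by auto
  then obtain i s' where s: "s = block_word (map e [0..<i]) \<frown> s'" "\<nexists>s''. s' = block (e i) \<frown> s''"
    using has_blocks_first_diff assms(1) by blast
  obtain t' where "t = block_word (map e [0..<i]) \<frown> (block (e i) \<frown> t')"
    using has_blocks_suffix assms(1) by blast
  then have "s' \<prec>\<^sub>u (block (e i) \<frown> t')" using assms(2) s by (simp add: uni_less_conc del: conc_conc)
  then show ?thesis using that s uni_less_not_prefix by blast
qed

lemma has_blocks_less:
  assumes "has_blocks e t" "s = block_word (map e [0..<i]) \<frown> (1 ## (replicate k 0 \<frown> s'))" "e i < k"
  shows "t \<prec>\<^sub>u s"
proof -
  obtain t' where "t = block_word (map e [0..<i]) \<frown> (block (e i) \<frown> t')"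
    using has_blocks_suffix assms(1) by blast
  then show ?thesis using block_less[OF assms(3)] assms(2) by (simp add: uni_less_conc del: conc_conc)
qed

section \<open>Reversing bi-infinite sequences\<close>

text \<open>\<open>E i\<close> stands for the total length of the first \<open>i\<close> blocks;
  \<open>block k\<close> has length \<open>k + 2\<close>.\<close>

definition gaps :: "(nat \<Rightarrow> nat) \<Rightarrow> nat \<Rightarrow> nat" where
  "gaps E i = E (Suc i) - E i - 2"

lemma gaps_eq: "E i + 2 \<le> E (Suc i) \<Longrightarrow> gaps E i + E i + 2 = E (Suc i)"
  by (simp add: gaps_def)

lemma sum_gaps:
  assumes "E 0 = 0" "\<And>i. E i + 2 \<le> E (Suc i)"
  shows "(\<Sum>k\<leftarrow>map (gaps E) [0..<i]. k + 2) = E i"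
proof (induction i)
  case (Suc i)
  then show ?case using gaps_eq[OF assms(2)[of i]] by simp
qed (simp add: assms)

text \<open>Look at the first entry that differs from \<open>gaps E\<close>. If it is larger, it is
  the one sought. If it is smaller, the initial part up to it has total at most
  \<open>E (Suc d) - 1\<close>; this gain of 1 pays for the defect in \<open>super\<close>, so the
  rest \<open>vs\<close> again exceeds \<open>E (length vs)\<close>.\<close>

lemma exceeding_sublist:
  assumes E0: "E 0 = 0" and step: "\<And>i. E i + 2 \<le> E (Suc i)"
    and super: "\<And>i j. E i + E j \<le> E (i + j) + 1"
    and "E (length ks) < (\<Sum>k\<leftarrow>ks. k + 2)"
  shows "\<exists>us d k vs. ks = us @ map (gaps E) [0..<d] @ k # vs \<and> gaps E d < k"
  using assms(4)
proof (induction ks rule: length_induct)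
  case (1 ks)
  have "\<exists>d<length ks. ks ! d \<noteq> gaps E d"
  proof (rule ccontr)
    assume "\<not> ?thesis"
    then have "ks = map (gaps E) [0..<length ks]" by (intro nth_equalityI) auto
    then show False using 1(2) sum_gaps[OF E0 step, of "length ks"] by simp
  qed
  then obtain d where d: "d < length ks" "ks ! d \<noteq> gaps E d"
    and least: "\<And>i. i < d \<Longrightarrow> ks ! i = gaps E i"
    using exists_least_iff[of "\<lambda>d. d < length ks \<and> ks ! d \<noteq> gaps E d"] by auto
  define vs where "vs = drop (Suc d) ks"
  have "take d ks = map (gaps E) [0..<d]"
    using d least by (intro nth_equalityI) auto
  then have ks: "ks = map (gaps E) [0..<d] @ ks ! d # vs"
    using d(1) by (metis id_take_nth_drop vs_def)
  show ?case
  proof (cases "gaps E d < ks ! d")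
    case True
    then show ?thesis using ks append_Nil by metis
  next
    case False
    then have "ks ! d < gaps E d" using d by simp
    moreover have "gaps E d + E d + 2 = E (Suc d)" using gaps_eq step by blast
    moreover have "(\<Sum>k\<leftarrow>ks. k + 2) = E d + (ks ! d + 2) + (\<Sum>k\<leftarrow>vs. k + 2)"
      using sum_gaps[OF E0 step, of d] by (subst ks) simp
    moreover have "length ks = Suc d + length vs" using d vs_def by simp
    moreover have "E (Suc d) + E (length vs) \<le> E (Suc d + length vs) + 1" by (rule super)
    ultimately have "E (length vs) < (\<Sum>k\<leftarrow>vs. k + 2)" using 1(2) by simp
    moreover have "length vs < length ks" using d vs_def by simp
    ultimately obtain us d' k ws where "vs = us @ map (gaps E) [0..<d'] @ k # ws" "gaps E d' < k"
      using 1(1) by blast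
    then have "ks = (map (gaps E) [0..<d] @ ks ! d # us) @ map (gaps E) [0..<d'] @ k # ws"
      using ks by simp
    then show ?thesis using \<open>gaps E d' < k\<close> by blast
  qed
qed

section \<open>Moving the base point, and reflection\<close>

lemma fwd_conc:
  assumes "fwd (bishift p S) = u \<frown> s"
  shows "bwd (bishift (p + int (length u)) S) = rev u \<frown> bwd (bishift p S)"
    "fwd (bishift (p + int (length u)) S) = s"
proof -
  have S: "S (p + int i) = (u \<frown> s) i" for i
    using fun_cong[OF assms, of i] by (simp add: fwd_def bishift_def add.commute)
  show "bwd (bishift (p + int (length u)) S) = rev u \<frown> bwd (bishift p S)"
  proof
    fix i
    show "bwd (bishift (p + int (length u)) S) i = (rev u \<frown> bwd (bishift p S)) i"
    proof (cases "i < length u")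
      case True
      have "bwd (bishift (p + int (length u)) S) i = S (p + int (length u - Suc i))"
        using True by (simp add: bwd_def bishift_def of_nat_diff algebra_simps)
      then show ?thesis using True S[of "length u - Suc i"] by (simp only: rev_nth conc_fst) (simp add: rev_nth)
    next
      case False
      then show ?thesis by (simp add: bwd_def bishift_def of_nat_diff algebra_simps)
    qed
  qed
  show "fwd (bishift (p + int (length u)) S) = s"
  proof
    fix i
    show "fwd (bishift (p + int (length u)) S) i = s i"
      using S[of "length u + i"] by (simp add: fwd_def bishift_def algebra_simps)
  qed
qed

text \<open>Reflection between positions -1 and 0, matching the offset in \<open>bwd\<close>, so
  that past and future are exchanged exactly.\<close>

definition reflect :: "(int \<Rightarrow> bit) \<Rightarrow> int \<Rightarrow> bit" where
  "reflect S = (\<lambda>i. S (- 1 - i))"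

lemma fwd_reflect: "fwd (bishift r (reflect S)) = bwd (bishift (- r) S)"
  and bwd_reflect: "bwd (bishift r (reflect S)) = fwd (bishift (- r) S)"
  by (simp_all add: fun_eq_iff fwd_def bwd_def bishift_def reflect_def algebra_simps)

lemma bwd_conc:
  assumes "bwd (bishift p S) = u \<frown> s"
  shows "fwd (bishift (p - int (length u)) S) = rev u \<frown> fwd (bishift p S)"
    "bwd (bishift (p - int (length u)) S) = s"
  using fwd_conc[of "- p" "reflect S" u s] assms by (simp_all add: fwd_reflect bwd_reflect)

lemma suffix_fwd: "suffix k (fwd (bishift r S)) = fwd (bishift (r + int k) S)"
  by (simp add: fun_eq_iff fwd_def bishift_def algebra_simps)

lemma ends_zeros_iff: "ends_zeros S \<longleftrightarrow> (\<exists>r. \<forall>i\<ge>r. S i = 0)"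
proof
  assume "ends_zeros S"
  then have "finite {i. S (int i) = 1}" by (simp add: ends_zeros_def fwd_def)
  then obtain N where N: "\<And>i. S (int i) = 1 \<Longrightarrow> i \<le> N"
    using finite_nat_set_iff_bounded_le by auto
  have "S i = 0" if "i \<ge> int N + 1" for i
    using N[of "nat i"] that by (cases "S i") auto
  then show "\<exists>r. \<forall>i\<ge>r. S i = 0" by blast
next
  assume "\<exists>r. \<forall>i\<ge>r. S i = 0"
  then obtain r where r: "\<forall>i\<ge>r. S i = 0" by blast
  have "i < nat r" if "S (int i) = 1" for i
    using that r by (cases "int i \<ge> r") auto
  then have "{i. S (int i) = 1} \<subseteq> {..<nat r}" by auto
  then show "ends_zeros S" using finite_subset by (auto simp: ends_zeros_def fwd_def)
qed

lemma split_at_one: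
  assumes "s i = (1::bit)"
  obtains z s' where "s = replicate z 0 \<frown> (1 ## s')"
proof -
  define z where "z = (LEAST i. s i = 1)"
  have z: "s z = 1" "\<And>j. j < z \<Longrightarrow> s j = 0"
    using LeastI[of "\<lambda>i. s i = 1" i] not_less_Least[of _ "\<lambda>i. s i = 1"] assms
    unfolding z_def bit_not_one_iff by blast+
  have "prefix z s = replicate z 0"
    by (rule nth_equalityI) (simp_all add: z)
  moreover have "suffix z s = 1 ## suffix (Suc z) s"
    using suffix_singleton_suffix[of s z] z(1) by simp
  ultimately have "s = replicate z 0 \<frown> (1 ## suffix (Suc z) s)"
    using prefix_suffix[of s z] by metis
  then show ?thesis using that by blast
qed

text \<open>
  A factor of \<open>S\<close> that exceeds the block expansion of \<open>t\<close> runs over \<open>i + 1\<close> blocks of total length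
  more than \<open>E (i + 1)\<close>. Read backwards it has the same total length, so by
  \<open>exceeding_sublist\<close> it contains a factor exceeding \<open>t\<close> again.
\<close>

lemma fwd_le_if_bwd_le:
  assumes E: "E 0 = 0" "\<And>i. E i + 2 \<le> E (Suc i)" "\<And>i j. E i + E j \<le> E (i + j) + 1"
    and t: "has_blocks (gaps E) t"
    and bwd: "\<And>r. bwd (bishift r S) \<preceq>\<^sub>u t"
    and ends: "\<not> ends_zeros S"
  shows "fwd (bishift p S) \<preceq>\<^sub>u t"
proof (rule ccontr)
  assume "\<not> ?thesis"
  then have "t \<prec>\<^sub>u fwd (bishift p S)" by (simp add: not_uni_le_iff)
  from greater_has_blocks[OF t this] obtain i s1 where
    s1: "fwd (bishift p S) = block_word (map (gaps E) [0..<i]) \<frown> s1"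
    "\<And>x. (block (gaps E i) \<frown> x) \<prec>\<^sub>u s1" "\<nexists>s''. s1 = block (gaps E i) \<frown> s''" by metis
  obtain s2 where s2: "s1 = 1 ## (replicate (Suc (gaps E i)) 0 \<frown> s2)"
    using greater_block_zeros[OF s1(2,3)] by blast
  define u where "u = block_word (map (gaps E) [0..<i]) @ 1 # replicate (Suc (gaps E i)) 0"
  have fu: "fwd (bishift p S) = u \<frown> s2"
    by (simp add: s1(1) s2 u_def)
  define p' where "p' = p + int (length u)"
  \<comment> \<open>As \<open>S\<close> does not end in zeros, the run of zeros is closed by a 1,
    and the excess becomes a complete block with exponent \<open>k > gaps E i\<close>.\<close>
  obtain j where j: "j \<ge> p'" "S j = 1" using ends unfolding ends_zeros_iff by auto
  have "s2 = fwd (bishift p' S)" using fwd_conc(2)[OF fu] p'_def by simp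
  then have "s2 (nat (j - p')) = 1" using j by (simp add: fwd_def bishift_def)
  then obtain z s3 where s3: "s2 = replicate z 0 \<frown> (1 ## s3)" using split_at_one by blast
  define k where "k = Suc (gaps E i) + z"
  define ks where "ks = map (gaps E) [0..<i] @ [k]"
  have "fwd (bishift p S) = block_word ks \<frown> s3"
    unfolding fu by (simp add: u_def s3 ks_def k_def block_def replicate_add) (simp flip: conc_conc)
  from fwd_conc(1)[OF this]
  have bw: "bwd (bishift (p + int (length (block_word ks))) S)
      = block_word (rev ks) \<frown> bwd (bishift p S)" by (simp add: rev_block_word)
  have "(\<Sum>k\<leftarrow>ks. k + 2) = E i + k + 2" using sum_gaps[OF E(1,2), of i] by (simp add: ks_def)
  then have "E (length (rev ks)) < (\<Sum>k\<leftarrow>rev ks. k + 2)"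
    using gaps_eq[OF E(2)[of i]] by (simp add: rev_map[symmetric] ks_def k_def)
  from exceeding_sublist[of E, OF E this]
  obtain us d k' vs where rev: "rev ks = us @ map (gaps E) [0..<d] @ k' # vs" and k': "gaps E d < k'"
    by blast
  \<comment> \<open>Moving the base point past the blocks \<open>us\<close> makes the exceeding
    factor the start of a backward sequence.\<close>
  obtain r x where "bwd (bishift r S) = block_word (map (gaps E) [0..<d]) \<frown> (block k' \<frown> x)"
  proof (rule that)
    show "bwd (bishift (p + int (length (block_word ks)) - int (length (block_word us))) S)
      = block_word (map (gaps E) [0..<d]) \<frown> (block k' \<frown> (block_word vs \<frown> bwd (bishift p S)))"
      by (rule bwd_conc(2)) (simp add: bw rev)
  qed
  then have "t \<prec>\<^sub>u bwd (bishift r S)"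
    using has_blocks_less[OF t _ k'] by (simp add: block_def)
  then show False using bwd not_uni_less_iff by blast
qed

text \<open>Reflected form of \<open>fwd_le_if_bwd_le\<close>: ones arbitrarily far to the left
  replace the condition on the right end.\<close>

lemma bwd_le_if_fwd_le:
  assumes E: "E 0 = 0" "\<And>i. E i + 2 \<le> E (Suc i)" "\<And>i j. E i + E j \<le> E (i + j) + 1"
    and t: "has_blocks (gaps E) t"
    and fwd: "\<And>r. fwd (bishift r S) \<preceq>\<^sub>u t"
    and ends: "\<And>r. \<exists>i\<le>r. S i = 1"
  shows "bwd (bishift p S) \<preceq>\<^sub>u t"
proof -
  have "\<not> ends_zeros (reflect S)"
  proof
    assume "ends_zeros (reflect S)"
    then obtain r where r: "\<And>i. i \<ge> r \<Longrightarrow> S (- 1 - i) = 0"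
      unfolding ends_zeros_iff reflect_def by blast
    obtain i where "i \<le> - 1 - r" "S i = 1" using ends by blast
    then show False using r[of "- 1 - i"] by simp
  qed
  then show ?thesis
    using fwd_le_if_bwd_le[OF E t, of "reflect S" "- p"] fwd by (simp add: fwd_reflect bwd_reflect)
qed

section \<open>Height\<close>

text \<open>The value at 0 is set separately, since the formula for positive \<open>i\<close> would
  give 1 there.\<close>

definition upper_sum :: "real \<Rightarrow> nat \<Rightarrow> nat" where
  "upper_sum q i = (if i = 0 then 0 else nat \<lfloor>real i / q\<rfloor> + 1)"

definition lower_sum :: "real \<Rightarrow> nat \<Rightarrow> nat" where
  "lower_sum q i = nat \<lceil>real i / q\<rceil>"

lemma upper_sum_0 [simp]: "upper_sum q 0 = 0"
  by (simp add: upper_sum_def)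

lemma lower_sum_0 [simp]: "lower_sum q 0 = 0"
  by (simp add: lower_sum_def)

lemma two_le_inverse: "0 < q \<Longrightarrow> q \<le> 1/2 \<Longrightarrow> 2 \<le> 1 / (q::real)"
  by (simp add: field_simps)

lemma upper_sum_step:
  assumes "0 < q" "q \<le> 1/2"
  shows "upper_sum q i + 2 \<le> upper_sum q (Suc i)"
proof -
  have "real i / q + 2 \<le> real (Suc i) / q"
    using two_le_inverse[OF assms] by (simp add: add_divide_distrib)
  then have "\<lfloor>real i / q\<rfloor> + 2 \<le> \<lfloor>real (Suc i) / q\<rfloor>" by linarith
  moreover have "0 \<le> \<lfloor>real i / q\<rfloor>" using assms by simp
  ultimately have "nat \<lfloor>real i / q\<rfloor> + 2 \<le> nat \<lfloor>real (Suc i) / q\<rfloor>" by linarith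
  then show ?thesis unfolding upper_sum_def by (auto simp del: of_nat_Suc)
qed

text \<open>Superadditivity of the floor. Of the two added ones on the left, one is matched inside
  \<open>upper_sum q (i + j)\<close>, the other by the explicit 1.\<close>

lemma upper_sum_super:
  assumes "0 < q"
  shows "upper_sum q i + upper_sum q j \<le> upper_sum q (i + j) + 1"
proof -
  have "real (i + j) / q = real i / q + real j / q" by (simp add: add_divide_distrib)
  then have "\<lfloor>real i / q\<rfloor> + \<lfloor>real j / q\<rfloor> \<le> \<lfloor>real (i + j) / q\<rfloor>" by linarith
  moreover have "0 \<le> \<lfloor>real i / q\<rfloor>" "0 \<le> \<lfloor>real j / q\<rfloor>" using assms by simp_all
  ultimately have "nat \<lfloor>real i / q\<rfloor> + nat \<lfloor>real j / q\<rfloor> \<le> nat \<lfloor>real (i + j) / q\<rfloor>" by linarith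
  then show ?thesis unfolding upper_sum_def by simp
qed

lemma lower_sum_step:
  assumes "0 < q" "q \<le> 1/2"
  shows "lower_sum q i + 2 \<le> lower_sum q (Suc i)"
proof -
  have "real i / q + 2 \<le> real (Suc i) / q"
    using two_le_inverse[OF assms] by (simp add: add_divide_distrib)
  then have "\<lceil>real i / q\<rceil> + 2 \<le> \<lceil>real (Suc i) / q\<rceil>" by linarith
  moreover have "0 \<le> \<lceil>real i / q\<rceil>" using assms
    by (metis ceiling_mono ceiling_zero divide_nonneg_pos of_nat_0_le_iff)
  ultimately show ?thesis unfolding lower_sum_def by linarith
qed

section \<open>Lowest terms, run lengths and the words \<open>c_word q\<close>\<close>

lemma rat_num_den:
  assumes "0 < q"
  shows "real_of_rat q = real (rat_num q) / real (rat_den q)"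
    "0 < rat_num q" "0 < rat_den q" "coprime (rat_num q) (rat_den q)"
proof -
  obtain a b where ab: "quotient_of q = (a, b)" by fastforce
  have b: "0 < b" and cop: "coprime a b" and q: "q = of_int a / of_int b"
    using ab quotient_of_denom_pos quotient_of_coprime quotient_of_div by blast+
  have a: "0 < a" using assms b unfolding q by (simp add: zero_less_divide_iff)
  show "0 < rat_num q" "0 < rat_den q" using a b ab by (simp_all add: rat_num_def rat_den_def)
  show "coprime (rat_num q) (rat_den q)"
    using a b cop ab by (simp add: rat_num_def rat_den_def coprime_int_iff[symmetric])
  show "real_of_rat q = real (rat_num q) / real (rat_den q)"
    using a b ab q by (simp add: rat_num_def rat_den_def of_rat_divide)
qed

lemma rat_num_den_eq:
  assumes "q = of_nat m / of_nat n" "n > 0" "coprime m n"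
  shows "rat_num q = m" "rat_den q = n"
proof -
  have "q = Fract (int m) (int n)" using assms(1) by (simp add: Fract_of_int_quotient)
  then have "quotient_of q = (int m, int n)"
    using assms(2,3) by (simp add: quotient_of_Fract normalize_def Let_def coprime_int_iff)
  then show "rat_num q = m" "rat_den q = n" by (simp_all add: rat_num_def rat_den_def)
qed

text \<open>The vertical lines counted are at the integers \<open>x\<close> with
  \<open>i \<le> q * x \<le> i + 1\<close>.\<close>

lemma run_length_eq:
  assumes "0 < q"
  shows "run_length q (Suc i) = nat (\<lfloor>real (Suc i) / q\<rfloor> - \<lceil>real i / q\<rceil> + 1) - 2"
proof -
  have "{x::int. \<exists>y\<in>{real (Suc i) - 1..real (Suc i)}. y = q * of_int x}
      = {\<lceil>real i / q\<rceil>..\<lfloor>real (Suc i) / q\<rfloor>}"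
    using assms by (auto simp: ceiling_le_iff le_floor_iff field_simps)
  then show ?thesis by (simp add: run_length_def)
qed

text \<open>\<open>i * n / m\<close> is not an integer, because \<open>m\<close> is coprime to
  \<open>n\<close> and does not divide \<open>i\<close>.\<close>

lemma ceiling_multiple_rat:
  assumes "0 < i" "i < m" "0 < n" "coprime m n"
  shows "\<lceil>real i / (real m / real n)\<rceil> = \<lfloor>real i / (real m / real n)\<rfloor> + 1"
proof -
  have "real i / (real m / real n) \<notin> \<int>"
  proof
    assume "real i / (real m / real n) \<in> \<int>"
    then obtain z where "real i / (real m / real n) = of_int z" by (auto elim: Ints_cases)
    then have "real i * real n = of_int z * real m" using assms by (simp add: field_simps)
    then have "int i * int n = z * int m" by (metis (mono_tags) of_int_eq_iff of_int_mult of_int_of_nat_eq)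
    then have "int m dvd int i * int n" by simp
    then have "m dvd i * n" by (metis int_dvd_int_iff of_nat_mult)
    then have "m dvd i" using assms(4) coprime_dvd_mult_left_iff by blast
    then show False using assms by (auto dest: dvd_imp_le)
  qed
  then show ?thesis by (simp add: ceiling_altdef)
      (metis Ints_of_int)
qed

lemma lower_sum_eq_upper_sum:
  assumes "0 < i" "i < m" "0 < n" "coprime m n"
  shows "lower_sum (real m / real n) i = upper_sum (real m / real n) i"
  using ceiling_multiple_rat[OF assms] assms
  by (simp add: lower_sum_def upper_sum_def nat_add_distrib)

text \<open>For positive \<open>i < m\<close> the ceiling exceeds the floor by one, so the counts
  are differences of floors. At \<open>i = 0\<close> the line \<open>x = 0\<close> is counted too,
  which accounts for the extra 1 in \<open>upper_sum\<close>.\<close>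

lemma run_length_eq_gaps:
  assumes "i < m" "0 < n" "coprime m n"
  shows "run_length (real m / real n) (Suc i) = gaps (upper_sum (real m / real n)) i"
proof (cases "i = 0")
  case True
  then show ?thesis using assms by (simp add: run_length_eq gaps_def upper_sum_def nat_add_distrib)
next
  case False
  have "0 \<le> \<lfloor>real i / (real m / real n)\<rfloor>" by simp
  moreover have "\<lfloor>real i / (real m / real n)\<rfloor> \<le> \<lfloor>real (Suc i) / (real m / real n)\<rfloor>"
    by (intro floor_mono divide_right_mono) auto
  moreover have "run_length (real m / real n) (Suc i)
      = nat (\<lfloor>real (Suc i) / (real m / real n)\<rfloor> - \<lfloor>real i / (real m / real n)\<rfloor>) - 2"
    using False assms run_length_eq[of "real m / real n" i] ceiling_multiple_rat[of i m n] by simp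
  moreover have "upper_sum (real m / real n) i = nat \<lfloor>real i / (real m / real n)\<rfloor> + 1"
    "upper_sum (real m / real n) (Suc i) = nat \<lfloor>real (Suc i) / (real m / real n)\<rfloor> + 1"
    using False by (simp_all add: upper_sum_def)
  ultimately show ?thesis unfolding gaps_def by linarith
qed

lemma c_word_eq:
  assumes "0 < q"
  shows "c_word q = block_word (map (gaps (upper_sum (of_rat q))) [0..<rat_num q])"
proof -
  have "map (\<lambda>i. [1] @ replicate (run_length (of_rat q) i) (0::bit) @ [1]) [1..<rat_num q + 1]
     = map (\<lambda>i. block (run_length (of_rat q) (Suc i))) [0..<rat_num q]"
    by (simp add: map_Suc_upt[symmetric] block_def del: upt_Suc)
  also have "\<dots> = map (\<lambda>i. block (gaps (upper_sum (of_rat q)) i)) [0..<rat_num q]"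
    using rat_num_den[OF assms] run_length_eq_gaps by simp
  finally show ?thesis by (simp add: c_word_def block_word_def comp_def)
qed

lemma iter_c_word_0: "(c_word q @ [0])\<^sup>\<omega> = c_word q \<frown> (0 ## (c_word q @ [0])\<^sup>\<omega>)"
  using iter_unroll[of "c_word q @ [0]"] by simp

section \<open>Strict bounds on the height from comparison with block expansions\<close>

lemma height_le:
  assumes "0 < q" "q \<le> 1/2" "(c_word q @ [0])\<^sup>\<omega> \<prec>\<^sub>u s"
  shows "height s \<le> of_rat q"
  unfolding height_def
proof (rule cInf_lower)
  show "bdd_below ({of_rat q |q. 0 < q \<and> q \<le> 1 / 2 \<and> (c_word q @ [0])\<^sup>\<omega> \<prec>\<^sub>u s} \<union> {1 / 2::real})"
    by (rule bdd_belowI[of _ 0]) auto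
qed (use assms in blast)

lemma height_ge:
  assumes "x \<le> 1/2"
    "\<And>q. 0 < q \<Longrightarrow> q \<le> 1/2 \<Longrightarrow> (c_word q @ [0])\<^sup>\<omega> \<prec>\<^sub>u s \<Longrightarrow> x \<le> of_rat q"
  shows "x \<le> height s"
  unfolding height_def by (rule cInf_greatest) (use assms in auto)

text \<open>For \<open>q'\<close> slightly below \<open>q\<close> the quotient \<open>j / q'\<close>
  is slightly above \<open>j / q\<close>, and the floor is continuous from the right.\<close>

lemma smaller_rat_upper_sum_eq:
  assumes "0 < q"
  obtains q' :: rat where "0 < q'" "q' < q"
    "\<And>j. j \<le> i \<Longrightarrow> upper_sum (of_rat q') j = upper_sum (of_rat q) j"
proof -
  define m n N where "m = rat_num q" and "n = rat_den q" and "N = Suc i"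
  \<comment> \<open>Thus 1/q' = 1/q + 1/(mN). For \<open>j < N\<close> the additional
    \<open>j\<close> vanishes in the division of \<open>j * n * N + j\<close> by
    \<open>N\<close>.\<close>
  define q' :: rat where "q' = of_nat (m * N) / of_nat (n * N + 1)"
  note q = rat_num_den[OF assms, folded m_def n_def]
  have q_eq: "q = of_nat m / of_nat n"
    using q(1) by (metis of_rat_divide of_rat_eq_iff of_rat_of_nat_eq)
  have "0 < q'" unfolding q'_def using q by (intro divide_pos_pos) (simp_all add: N_def del: of_nat_mult of_nat_add)
  moreover have "q' < q"
  proof -
    have "m * N * n < m * (n * N + 1)" using q by (simp add: algebra_simps)
    then have "of_nat (m * N) * of_nat n < (of_nat m * of_nat (n * N + 1) :: rat)"
      by (metis of_nat_less_iff of_nat_mult)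
    moreover have "0 < (of_nat n :: rat)" "0 < (of_nat (n * N + 1) :: rat)"
      using q by (simp_all only: of_nat_0_less_iff)
    ultimately show ?thesis unfolding q_eq q'_def by (simp add: divide_less_eq less_divide_eq mult.commute)
  qed
  moreover have "upper_sum (of_rat q') j = upper_sum (of_rat q) j" if "j \<le> i" for j
  proof -
    have "real j / of_rat q' = real (j * (n * N + 1)) / real (N * m)"
      by (simp add: q'_def of_rat_divide of_rat_mult of_rat_add algebra_simps)
    then have 1: "\<lfloor>real j / of_rat q'\<rfloor> = int ((j * (n * N + 1)) div (N * m))"
      using floor_divide_of_nat_eq by metis
    have "real j / of_rat q = real (j * n) / real m" using q by simp
    then have 2: "\<lfloor>real j / of_rat q\<rfloor> = int ((j * n) div m)"
      using floor_divide_of_nat_eq by metis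
    have "(j * (n * N + 1)) div (N * m) = ((j * n) * N + j) div N div m"
      by (simp add: div_mult2_eq algebra_simps)
    also have "((j * n) * N + j) div N = j * n"
      using that by (subst div_mult_self3) (simp_all add: N_def del: mult_Suc_right)
    finally show ?thesis using 1 2 by (simp add: upper_sum_def)
  qed
  ultimately show ?thesis using that by blast
qed

lemma block_word_upt_split:
  assumes "i < k"
  shows "block_word (map g [0..<k]) \<frown> x
    = block_word (map g [0..<i]) \<frown> (block (g i) \<frown> (block_word (map g [Suc i..<k]) \<frown> x))"
proof -
  have "[0..<k] = [0..<i] @ i # [Suc i..<k]"
    using assms by (metis less_imp_add_positive upt_add_eq_append upt_conv_Cons zero_le less_add_same_cancel1)
  then show ?thesis by simp
qed

text \<open>The excess of \<open>s\<close> over \<open>t\<close> shows in block \<open>i\<close>. A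
  rational \<open>q' < q\<close> with the same sums up to \<open>i + 1\<close> gives a sequence that
  shares these blocks with \<open>t\<close>, or reads the 0 after \<open>c_word q'\<close> earlier,
  where \<open>s\<close> has a 1. Both put it below \<open>s\<close>, so the height is at most
  \<open>q'\<close>.\<close>

lemma height_less:
  assumes q: "0 < q" "q \<le> 1/2"
    and t: "has_blocks (gaps (upper_sum (of_rat q))) t" and less: "t \<prec>\<^sub>u s"
  shows "height s < of_rat q"
proof -
  let ?e = "gaps (upper_sum (of_rat q))"
  obtain i s' where s: "s = block_word (map ?e [0..<i]) \<frown> s'"
    and s': "\<And>x. (block (?e i) \<frown> x) \<prec>\<^sub>u s'"
    using greater_has_blocks[OF t less] by metis
  obtain q' where q': "0 < q'" "q' < q"
    and eq: "\<And>j. j \<le> Suc i \<Longrightarrow> upper_sum (of_rat q') j = upper_sum (of_rat q) j"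
    using smaller_rat_upper_sum_eq[OF q(1)] by metis
  define m' where "m' = rat_num q'"
  define x where "x = (c_word q' @ [0])\<^sup>\<omega>"
  let ?e' = "gaps (upper_sum (of_rat q'))"
  have e': "?e' j = ?e j" if "j \<le> i" for j using eq that by (simp add: gaps_def)
  have c: "c_word q' = block_word (map ?e' [0..<m'])" using c_word_eq[OF q'(1)] m'_def by simp
  have x: "x = block_word (map ?e' [0..<m']) \<frown> (0 ## x)"
    using iter_c_word_0[of q'] unfolding x_def c .
  have "x \<prec>\<^sub>u s"
  proof (cases "i < m'")
    case True
    have "x = block_word (map ?e' [0..<i]) \<frown> (block (?e' i) \<frown> (block_word (map ?e' [Suc i..<m']) \<frown> (0 ## x)))"
      by (subst x) (rule block_word_upt_split[OF True])
    moreover have "map ?e' [0..<i] = map ?e [0..<i]" "?e' i = ?e i" using e' by simp_all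
    ultimately obtain y where "x = block_word (map ?e [0..<i]) \<frown> (block (?e i) \<frown> y)"
      by metis
    then show ?thesis unfolding s using s'[of y] by (simp only: uni_less_conc even_word_block_word if_True)
  next
    case False
    then have m': "map ?e' [0..<m'] = map ?e [0..<m']" using e' by simp
    \<comment> \<open>If \<open>i = m'\<close>, the remainder \<open>s'\<close> exceeds a block and
      so starts with 1; otherwise another full block follows.\<close>
    obtain s1 where s1: "s = block_word (map ?e [0..<m']) \<frown> (1 ## s1)"
    proof (cases "i = m'")
      case True
      have "s' 0 = 1"
      proof (rule ccontr)
        assume "s' 0 \<noteq> 1"
        then have "s' = 0 ## suffix 1 s'" using build_split[of s'] by simp
        then show False using s'[of x] by (metis append_Cons block_def build_cons uni_less_build(2))
      qed
      then have "s' = 1 ## suffix 1 s'" using build_split[of s'] by simp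
      then show ?thesis using that s True by metis
    next
      case neq: False
      have "m' < i" using False neq by simp
      from block_word_upt_split[OF this, of ?e s'] s that show ?thesis
        by (simp add: block_def del: conc_conc)
    qed
    show ?thesis unfolding s1 by (subst x) (simp add: m' uni_less_conc)
  qed
  then have "height s \<le> of_rat q'" using height_le[of q' s] q q' by (simp add: x_def)
  also have "\<dots> < of_rat q" using q' by (simp add: of_rat_less)
  finally show ?thesis .
qed

text \<open>All rationals \<open>q'\<close> below some \<open>y > Q\<close> are excluded from the
  infimum: their upper sums dominate the lower sums of \<open>Q\<close> up to index
  \<open>i + 1\<close>, so the periodic sequence of \<open>q'\<close> lies above
  \<open>s\<close>.\<close>

lemma height_greater:
  assumes q: "0 < q" "q < 1/2"
    and t: "has_blocks (gaps (lower_sum (of_rat q))) t" and less: "s \<prec>\<^sub>u t"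
  shows "of_rat q < height s"
proof -
  define Q :: real where "Q = of_rat q"
  have Q: "0 < Q" "Q < 1/2"
    using q of_rat_less[of q "1/2", where 'a = real] by (simp_all add: Q_def of_rat_divide)
  let ?l = "gaps (lower_sum Q)"
  obtain i s' where s: "s = block_word (map ?l [0..<i]) \<frown> s'"
    and s': "\<And>x. s' \<prec>\<^sub>u (block (?l i) \<frown> x)"
    using less_has_blocks[OF t less] Q_def by metis
  \<comment> \<open>Only finitely many \<open>j\<close> matter, and
    \<open>\<lceil>j / Q\<rceil> - 1\<close> is strictly below \<open>j / Q\<close>, so the
    inequality persists slightly to the right of \<open>Q\<close>.\<close>
  have "\<forall>\<^sub>F y in at_right Q. \<forall>j\<in>{1..Suc i}. of_int (\<lceil>real j / Q\<rceil> - 1) < real j / y"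
  proof (intro eventually_ball_finite ballI)
    fix j assume "j \<in> {1..Suc i}"
    have "((\<lambda>y. real j / y) \<longlongrightarrow> real j / Q) (at_right Q)"
      using Q by (intro tendsto_intros) auto
    moreover have "of_int (\<lceil>real j / Q\<rceil> - 1) < real j / Q" by linarith
    ultimately show "\<forall>\<^sub>F y in at_right Q. of_int (\<lceil>real j / Q\<rceil> - 1) < real j / y"
      by (rule order_tendstoD)
  qed simp
  moreover have "\<forall>\<^sub>F y in at_right Q. Q < y \<and> y < 1/2"
    using Q by (intro eventually_conj eventually_at_right_less)
      (auto simp: eventually_at_right_field intro: exI[of _ "1/2"])
  ultimately obtain y where y: "Q < y" "y < 1/2"
    and yj: "\<forall>j\<in>{1..Suc i}. of_int (\<lceil>real j / Q\<rceil> - 1) < real j / y"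
    using eventually_happens'[OF trivial_limit_at_right_real eventually_conj] by blast
  have "y \<le> height s"
  proof (rule height_ge)
    fix q' :: rat
    assume q': "0 < q'" "q' \<le> 1/2" and lt: "(c_word q' @ [0])\<^sup>\<omega> \<prec>\<^sub>u s"
    show "y \<le> of_rat q'"
    proof (rule ccontr)
      assume "\<not> ?thesis"
      then have Q'y: "of_rat q' < y" by simp
      define Q' :: real where "Q' = of_rat q'"
      have Q': "0 < Q'" "Q' < y" "Q' \<le> 1/2"
        using q' Q'y y by (simp_all add: Q'_def)
      define m' n' where "m' = rat_num q'" and "n' = rat_den q'"
      note mn = rat_num_den[OF q'(1), folded m'_def n'_def Q'_def]
      let ?e = "gaps (upper_sum Q')"
      define x where "x = (c_word q' @ [0])\<^sup>\<omega>"
      have c: "c_word q' = block_word (map ?e [0..<m'])" using c_word_eq[OF q'(1)] m'_def Q'_def by simp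
      have x: "x = block_word (map ?e [0..<m']) \<frown> (0 ## x)"
        using iter_c_word_0[of q'] unfolding x_def c .
      have floor: "\<lceil>real j / Q\<rceil> - 1 < real j / Q'" if "j \<in> {1..Suc i}" for j
      proof -
        have "real j / y \<le> real j / Q'" using Q' by (intro divide_left_mono) auto
        then show ?thesis using yj that by fastforce
      qed
      have ge: "lower_sum Q j \<le> upper_sum Q' j" if "j \<le> Suc i" for j
      proof (cases "j = 0")
        case False
        then have "\<lceil>real j / Q\<rceil> - 1 \<le> \<lfloor>real j / Q'\<rfloor>"
          using floor[of j] that by (simp add: le_floor_iff)
        then have "nat \<lceil>real j / Q\<rceil> \<le> nat \<lfloor>real j / Q'\<rfloor> + 1" by linarith
        then show ?thesis using False unfolding lower_sum_def upper_sum_def by simp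
      qed simp
      \<comment> \<open>At \<open>m'\<close> the quotient is the integer \<open>n'\<close>, and the
        added 1 makes the domination strict. Hence the first strict index comes before the blocks of
        \<open>c_word q'\<close> run out.\<close>
      have gt: "lower_sum Q m' < upper_sum Q' m'" if "m' \<le> Suc i"
      proof -
        have *: "real m' / Q' = real n'" using mn by simp
        have "\<lceil>real m' / Q\<rceil> - 1 < int n'" using floor[of m'] that mn unfolding * by simp
        then show ?thesis using mn(2) unfolding upper_sum_def lower_sum_def * by simp
      qed
      \<comment> \<open>\<open>j\<close> is the first block at which the sums separate, capped at
        the block \<open>i\<close> where \<open>s\<close> departs from \<open>t\<close>.\<close>
      let ?P = "\<lambda>j. lower_sum Q (Suc j) < upper_sum Q' (Suc j) \<or> i \<le> j"
      define j where "j = (LEAST j. ?P j)"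
      have Pj: "?P j" unfolding j_def by (rule LeastI[of ?P i]) simp
      have least: "lower_sum Q (Suc j') = upper_sum Q' (Suc j')" if "j' < j" for j'
      proof -
        have "\<not> ?P j'" using that not_less_Least unfolding j_def by blast
        then show ?thesis using ge[of "Suc j'"] by simp
      qed
      have ji: "j \<le> i" unfolding j_def by (rule Least_le) simp
      have jm: "j < m'"
      proof (cases "m' \<le> Suc i")
        case True
        then have "?P (m' - 1)" using gt mn(2) by simp
        then have "j \<le> m' - 1" unfolding j_def by (rule Least_le)
        then show ?thesis using mn(2) by simp
      qed (use ji in simp)
      have sums: "lower_sum Q j' = upper_sum Q' j'" if "j' \<le> j" for j'
        using least[of "j' - 1"] that by (cases j') auto
      have el: "map ?e [0..<j] = map ?l [0..<j]" using sums by (simp add: gaps_def)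
      define z where "z = block_word (map ?e [Suc j..<m']) \<frown> (0 ## x)"
      have x': "x = block_word (map ?l [0..<j]) \<frown> (block (?e j) \<frown> z)"
        unfolding z_def el[symmetric] by (subst x) (rule block_word_upt_split[OF jm])
      have "s \<prec>\<^sub>u x"
      proof (cases "j < i")
        case True
        have "lower_sum Q (Suc j) < upper_sum Q' (Suc j)" using Pj True by simp
        then have "?l j < ?e j" using sums[of j] lower_sum_step[of Q j] Q
          by (simp add: gaps_def)
        then show ?thesis unfolding x' s block_word_upt_split[OF True, of ?l s']
          by (simp add: uni_less_conc block_less_block del: conc_conc)
      next
        case False
        then have [simp]: "j = i" using ji by simp
        have "?l i \<le> ?e i" using sums[of i] ge[of "Suc i"] by (simp add: gaps_def)
        then have "s' \<prec>\<^sub>u (block (?e i) \<frown> z)"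
          using s' block_less_block uni_less_trans le_neq_implies_less by metis
        then show ?thesis unfolding x' s by (simp add: uni_less_conc del: conc_conc)
      qed
      then show False using lt uni_less_asym x_def by blast
    qed
  qed (use y in simp)
  then show ?thesis using y Q_def by simp
qed

text \<open>For \<open>q < 1 / (k + 2)\<close> the first block of \<open>c_word q\<close> has more
  than \<open>k\<close> zeros, so its periodic sequence exceeds \<open>s\<close>.\<close>

lemma height_pos:
  assumes "s = 1 ## (replicate k 0 \<frown> (1 ## s'))"
  shows "0 < height s"
proof -
  have "1 / (real k + 2) \<le> height s"
  proof (rule height_ge)
    fix q :: rat
    assume q: "0 < q" "q \<le> 1/2" and lt: "(c_word q @ [0])\<^sup>\<omega> \<prec>\<^sub>u s"
    show "1 / (real k + 2) \<le> of_rat q"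
    proof (rule ccontr)
      assume "\<not> ?thesis"
      then have "real k + 2 < 1 / of_rat q" using q by (simp add: field_simps)
      then have "int k + 2 \<le> \<lfloor>1 / of_rat q :: real\<rfloor>" by (simp add: le_floor_iff)
      then have k: "k < gaps (upper_sum (of_rat q)) 0" by (simp add: gaps_def upper_sum_def)
      define x where "x = 0 ## (c_word q @ [0])\<^sup>\<omega>"
      have "(c_word q @ [0])\<^sup>\<omega> = c_word q \<frown> x" using iter_c_word_0 x_def by blast
      also have "\<dots> = block_word (map (gaps (upper_sum (of_rat q))) [0..<rat_num q]) \<frown> x"
        using c_word_eq q by simp
      also have "\<dots> = block (gaps (upper_sum (of_rat q)) 0) \<frown>
          (block_word (map (gaps (upper_sum (of_rat q))) [Suc 0..<rat_num q]) \<frown> x)"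
        using block_word_upt_split[of 0 "rat_num q"] rat_num_den(2)[OF q(1)] by simp
      finally show False using lt block_less_block[OF k] assms uni_less_asym
        by (metis block_def append_Cons build_append build_cons conc_empty)
    qed
  qed simp
  moreover have "0 < 1 / (real k + 2)" by simp
  ultimately show ?thesis by linarith
qed

section \<open>The words \<open>lhe\<close> and \<open>rhe\<close>\<close>

lemma map_upt_add: "map f [m..<m + k] = map (\<lambda>i. f (i + m)) [0..<k]"
  by (simp add: map_add_upt[symmetric] add.commute comp_def)

lemma has_blocks_conc:
  assumes "has_blocks (\<lambda>i. g (i + m)) t"
  shows "has_blocks g (block_word (map g [0..<m]) \<frown> t)"
  unfolding has_blocks_def
proof
  fix i
  show "\<exists>t'. block_word (map g [0..<m]) \<frown> t = block_word (map g [0..<i]) \<frown> t'"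
  proof (cases "i < m")
    case True
    then show ?thesis using block_word_upt_split by blast
  next
    case False
    obtain t' where t': "t = block_word (map (\<lambda>j. g (j + m)) [0..<i - m]) \<frown> t'"
      using assms unfolding has_blocks_def by blast
    have "map g [0..<i] = map g [0..<m] @ map (\<lambda>j. g (j + m)) [0..<i - m]"
      using False map_upt_add[of g m "i - m"] upt_add_eq_append[of 0 m "i - m"] by simp
    then show ?thesis using t' by auto
  qed
qed

lemma has_blocks_iter:
  assumes "0 < m" "\<And>i. g (i + m) = g i"
  shows "has_blocks g ((block_word (map g [0..<m]))\<^sup>\<omega>)"
  unfolding has_blocks_def
proof
  fix i
  let ?u = "block_word (map g [0..<m])"
  have "0 < length ?u" using assms(1) by (subst upt_conv_Cons) auto
  note unroll = iter_unroll[OF this]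
  show "\<exists>t'. ?u\<^sup>\<omega> = block_word (map g [0..<i]) \<frown> t'"
  proof (induction i rule: less_induct)
    case (less i)
    show ?case
    proof (cases "i < m")
      case True
      then show ?thesis using block_word_upt_split[OF True] unroll by metis
    next
      case False
      obtain t' where "?u\<^sup>\<omega> = block_word (map g [0..<i - m]) \<frown> t'"
        using less[of "i - m"] False assms(1) by auto
      moreover have "map g [0..<i] = map g [0..<m] @ map g [0..<i - m]"
        using False map_upt_add[of g m "i - m"] upt_add_eq_append[of 0 m "i - m"] assms(2) by simp
      ultimately have "?u\<^sup>\<omega> = block_word (map g [0..<i]) \<frown> t'"
        by (subst unroll) simp
      then show ?thesis by blast
    qed
  qed
qed

text \<open>If \<open>S\<close> had a first 1, the backward sequence starting at it would be 1
  0^\<infinity>, which exceeds every block expansion.\<close>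

lemma ends_ones_if_bwd_le:
  assumes t: "has_blocks e t" and bwd: "\<And>r. bwd (bishift r S) \<preceq>\<^sub>u t" and ends: "\<not> ends_zeros S"
  shows "\<exists>i\<le>r. S i = 1"
proof (rule ccontr)
  assume "\<not> ?thesis"
  then have zero: "S i = 0" if "i \<le> r" for i using that by auto
  obtain j where j: "j \<ge> r" "S j = 1" using ends unfolding ends_zeros_iff by auto
  then have "fwd (bishift r S) (nat (j - r)) = 1" by (simp add: fwd_def bishift_def)
  then obtain z s' where "fwd (bishift r S) = replicate z 0 \<frown> (1 ## s')" using split_at_one by blast
  then have "fwd (bishift r S) = (replicate z 0 @ [1]) \<frown> s'" by simp
  note bw = fwd_conc(1)[OF this]
  define r' where "r' = r + int (length (replicate z (0::bit) @ [1]))"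
  have "bwd (bishift r S) = (\<lambda>_. 0)" by (simp add: fun_eq_iff bwd_def bishift_def zero)
  moreover have "replicate k 0 \<frown> (\<lambda>_. 0) = (\<lambda>_. 0::bit)" for k by (simp add: fun_eq_iff conc_def)
  ultimately have "bwd (bishift r' S) = 1 ## (replicate (Suc (e 0)) 0 \<frown> (\<lambda>_. 0))"
    using bw unfolding r'_def by (simp del: replicate_Suc)
  then have "t \<prec>\<^sub>u bwd (bishift r' S)"
    using has_blocks_less[OF t, of "bwd (bishift r' S)" 0 "Suc (e 0)"] by (simp del: replicate_Suc)
  then show False using bwd not_uni_less_iff by blast
qed

lemma first_diff_concD:
  assumes "first_diff r (u \<frown> s) (u \<frown> t)"
  shows "length u \<le> r" "first_diff (r - length u) s t"
proof -
  show *: "length u \<le> r"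
    using assms unfolding first_diff_def by (metis conc_fst not_le)
  have "s i = t i" if "i < r - length u" for i
    using assms that unfolding first_diff_def
    by (metis add.commute add_diff_cancel_right' conc_snd less_diff_conv not_add_less1 trans_less_add1)
  then show "first_diff (r - length u) s t"
    using assms * unfolding first_diff_def by simp
qed

text \<open>Strip common copies of \<open>u\<close> from \<open>t\<close> and \<open>p\<close>; each
  shortens the common prefix, so this stops. Once \<open>t\<close> does not begin with
  \<open>u\<close>, the tail after \<open>u\<close> in \<open>u \<frown> p\<close> may be replaced
  by \<open>t\<close>.\<close>

lemma less_conc_self:
  assumes u: "u \<noteq> []" "even_word u" and p: "p = u \<frown> p" and less: "t \<prec>\<^sub>u p"
  shows "t \<prec>\<^sub>u (u \<frown> t)"
proof -
  obtain r where "first_diff r t p" using less uni_less_iff by blast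
  then show ?thesis using less
  proof (induction r arbitrary: t rule: less_induct)
    case (less r)
    show ?case
    proof (cases "\<exists>t1. t = u \<frown> t1")
      case True
      then obtain t1 where t1: "t = u \<frown> t1" by blast
      have "first_diff r (u \<frown> t1) (u \<frown> p)" using less.prems(1) p t1 by simp
      note fd = first_diff_concD[OF this]
      have "0 < length u" using u(1) by simp
      then have "r - length u < r" "first_diff (r - length u) t1 p" using fd by linarith+
      moreover have "t1 \<prec>\<^sub>u p" using less.prems(2) p t1 uni_less_conc u(2) by metis
      ultimately have "t1 \<prec>\<^sub>u (u \<frown> t1)" using less.IH by blast
      then show ?thesis unfolding t1 using u(2) by (simp add: uni_less_conc del: conc_conc)
    next
      case False
      then show ?thesis using uni_less_not_prefix less.prems(2) p by metis
    qed
  qed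
qed

section \<open>Arithmetic and block structure of the words attached to \<open>q\<close>\<close>

locale height_words =
  fixes q :: rat
  assumes q_pos: "0 < q" and q_less: "q < 1/2"
begin

definition "Q = real_of_rat q"
definition "m = rat_num q"
definition "n = rat_den q"
definition "c = c_word q"
definition "w = w_word q"
text \<open>The periodic tail of \<open>rhe q\<close>, left over when the common prefix
  \<open>c\<close> is removed.\<close>

definition "p = (1 # rev w)\<^sup>\<omega>"
definition "e = gaps (upper_sum Q)"
definition "lo = gaps (lower_sum Q)"

lemma Q: "0 < Q" "Q < 1/2" "Q = real m / real n" "0 < m" "0 < n" "coprime m n"
  using q_pos q_less of_rat_less[of q "1/2", where 'a = real] rat_num_den[OF q_pos]
  by (simp_all add: Q_def of_rat_divide m_def n_def)

lemma E: "upper_sum Q 0 = 0" "upper_sum Q i + 2 \<le> upper_sum Q (Suc i)"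
  "upper_sum Q i + upper_sum Q j \<le> upper_sum Q (i + j) + 1"
  using upper_sum_step upper_sum_super Q(1,2) by simp_all

lemma m_div_Q: "real m / Q = real n"
  unfolding Q(3) using Q(4) by simp

lemma div_Q_add: "real (i + m) / Q = real i / Q + real n"
  using m_div_Q by (simp add: add_divide_distrib)

lemma upper_sum_add: "0 < i \<Longrightarrow> upper_sum Q (i + m) = upper_sum Q i + n"
  using Q(1) unfolding upper_sum_def div_Q_add by (simp add: nat_add_distrib)

lemma upper_sum_m: "upper_sum Q m = n + 1"
  using Q by (simp add: upper_sum_def)

lemma lower_sum_add: "lower_sum Q (i + m) = lower_sum Q i + n"
proof -
  have "0 \<le> real i / Q" using Q(1) by simp
  then have "nat \<lceil>real i / Q + real n\<rceil> = nat \<lceil>real i / Q\<rceil> + n" by linarith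
  then show ?thesis unfolding lower_sum_def div_Q_add .
qed

lemma lower_sum_eq: "i < m \<Longrightarrow> lower_sum Q i = upper_sum Q i"
  using lower_sum_eq_upper_sum Q by (cases "i = 0") auto

lemma lower_sum_m: "lower_sum Q m = n"
  using lower_sum_add[of 0] by simp

text \<open>For \<open>0 < j < m\<close> the number \<open>j / Q\<close> is not an integer, so the
  floor of \<open>n - j / Q\<close> is \<open>n - 1 - \<lfloor>j / Q\<rfloor>\<close>. This symmetry
  makes \<open>c\<close> a palindrome.\<close>

lemma upper_sum_diff: "j \<le> m \<Longrightarrow> upper_sum Q m - upper_sum Q j = upper_sum Q (m - j)"
proof (cases "j = 0 \<or> j = m")
  case False
  moreover assume "j \<le> m"
  ultimately have j: "0 < j" "j < m" by simp_all
  have "real (m - j) / Q = real n - real j / Q" using j m_div_Q by (simp add: of_nat_diff diff_divide_distrib)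
  moreover have "\<lceil>real j / Q\<rceil> = \<lfloor>real j / Q\<rfloor> + 1"
    using ceiling_multiple_rat[OF j Q(5,6)] Q(3) by simp
  ultimately have "\<lfloor>real (m - j) / Q\<rfloor> = int n - \<lfloor>real j / Q\<rfloor> - 1" by linarith
  moreover have "0 \<le> \<lfloor>real j / Q\<rfloor>" using Q(1) by simp
  moreover have "0 \<le> \<lfloor>real (m - j) / Q\<rfloor>" using Q(1) by simp
  ultimately have "n + 1 - (nat \<lfloor>real j / Q\<rfloor> + 1) = nat \<lfloor>real (m - j) / Q\<rfloor> + 1" by linarith
  moreover have "upper_sum Q j = nat \<lfloor>real j / Q\<rfloor> + 1"
    "upper_sum Q (m - j) = nat \<lfloor>real (m - j) / Q\<rfloor> + 1"
    using j by (simp_all add: upper_sum_def)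
  ultimately show ?thesis unfolding upper_sum_m by metis
qed auto

lemma upper_sum_mono: "i \<le> j \<Longrightarrow> upper_sum Q i \<le> upper_sum Q j"
  by (rule lift_Suc_mono_le[of "upper_sum Q"]) (use E(2) add_leD1 in blast)+

lemma e_palindrome:
  assumes "j < m"
  shows "e (m - Suc j) = e j"
proof -
  have "upper_sum Q j \<le> upper_sum Q m" "upper_sum Q (Suc j) \<le> upper_sum Q m"
    using assms by (intro upper_sum_mono; simp)+
  moreover have "Suc (m - Suc j) = m - j" using assms by simp
  moreover have "upper_sum Q m - upper_sum Q j = upper_sum Q (m - j)"
    "upper_sum Q m - upper_sum Q (Suc j) = upper_sum Q (m - Suc j)"
    using upper_sum_diff assms by simp_all
  ultimately have "upper_sum Q (m - j) - upper_sum Q (m - Suc j) = upper_sum Q (Suc j) - upper_sum Q j"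
    using E(2)[of j] by linarith
  with \<open>Suc (m - Suc j) = m - j\<close> show ?thesis unfolding e_def gaps_def by auto
qed

lemma c_eq: "c = block_word (map e [0..<m])"
  using c_word_eq[OF q_pos] by (simp add: c_def e_def m_def Q_def)

lemma rev_c: "rev c = c"
proof -
  have "rev (map e [0..<m]) = map e [0..<m]"
    by (rule nth_equalityI) (simp_all add: rev_nth e_palindrome)
  then show ?thesis by (simp add: c_eq rev_block_word)
qed

lemma length_c: "length c = n + 1"
  using sum_gaps[OF E(1,2), of m] by (simp add: c_eq length_block_word e_def upper_sum_m)

lemma even_c: "even_word c"
  by (simp add: c_eq)

text \<open>A zero in the outer blocks lets \<open>c\<close> begin with 10 and end with 01.\<close>

lemma e_0: "0 < e 0"
proof -
  have "2 < 1 / Q" using Q(1,2) by (simp add: field_simps)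
  then have "2 \<le> \<lfloor>1 / Q\<rfloor>" by linarith
  then show ?thesis by (simp add: e_def gaps_def upper_sum_def)
qed

lemma upt_m: "[0..<m] = [0..<m - 1] @ [m - 1]" "[0..<m] = 0 # [Suc 0..<m]"
  using Q(4) by (simp_all add: upt_conv_Cons flip: upt_Suc_append)

text \<open>Replacing the final 01 of \<open>c\<close> by 1 deletes one zero from the last block.
  Correspondingly, the lower sums agree with the upper sums below \<open>m\<close> and are one less
  at \<open>m\<close>.\<close>

lemma w_block_word:
  shows c_w: "c = w @ [0, 1]" and w_1: "w @ [1] = block_word (map lo [0..<m])"
proof -
  define P where "P = block_word (map e [0..<m - 1])"
  have em: "e (m - 1) = e 0" using e_palindrome[of 0] Q(4) by simp
  define k where "k = e (m - 1) - 1"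
  have k: "e (m - 1) = Suc k" using e_0 em k_def by simp
  have "c = P @ block (Suc k)" unfolding c_eq P_def by (subst upt_m(1)) (simp flip: k)
  also have "block (Suc k) = (1 # replicate k 0) @ [0, 1]"
    by (simp add: block_def replicate_append_same flip: replicate_Suc)
  finally have c': "c = (P @ 1 # replicate k 0) @ [0, 1]" by simp
  then have "length (P @ 1 # replicate k (0::bit)) = n - 1" using length_c by simp
  then have w': "w = P @ 1 # replicate k 0"
    unfolding w_def w_word_def c_def[symmetric] n_def[symmetric] c'
    by (subst take_append) (simp del: append_assoc)
  show "c = w @ [0, 1]" using c' w' by simp
  have lo_e: "map lo [0..<m - 1] = map e [0..<m - 1]"
    by (simp add: lo_def e_def gaps_def lower_sum_eq)
  have "lower_sum Q (m - 1) = upper_sum Q (m - 1)" using Q(4) lower_sum_eq[of "m - 1"] by simp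
  then have "lo (m - 1) = k"
    using Q(4) E(2)[of "m - 1"] by (simp add: k_def lo_def e_def gaps_def lower_sum_m upper_sum_m)
  then show "w @ [1] = block_word (map lo [0..<m])"
    using w' P_def unfolding upt_m(1) map_append lo_e by (simp add: block_def)
qed

lemma odd_w: "\<not> even_word w"
  using even_c c_w by simp

lemma has_blocks_lhe: "has_blocks lo (lhe q)"
proof -
  have "lo (i + m) = lo i" for i
    using lower_sum_add[of i] lower_sum_add[of "Suc i"] by (simp add: lo_def gaps_def)
  from has_blocks_iter[of m lo, OF Q(4) this] show ?thesis using w_1 by (simp add: lhe_def w_def)
qed

lemma rhe_eq: "rhe q = c \<frown> p"
  by (simp add: rhe_def c_def p_def w_def)

text \<open>The palindrome \<open>c\<close> equals 10 followed by \<open>rev w\<close>, so the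
  period \<open>1 # rev w\<close> of the tail is \<open>c\<close> with one zero deleted from its
  first block.\<close>

lemma has_blocks_rhe: "has_blocks e (rhe q)"
proof -
  have per: "e (i + m) = e i" if "0 < i" for i
    using upper_sum_add[of i] upper_sum_add[of "Suc i"] that by (simp add: e_def gaps_def)
  \<comment> \<open>Periodicity fails at index 0, since \<open>upper_sum Q 0\<close> is 0 while
    \<open>upper_sum Q m\<close> is \<open>n + 1\<close>.\<close>
  have e_m: "e m = e 0 - 1"
    using upper_sum_add[of 1] by (simp add: e_def gaps_def upper_sum_m)
  define rest where "rest = block_word (map e [Suc 0..<m])"
  define k where "k = e 0 - 1"
  have k: "e 0 = Suc k" using e_0 k_def by simp
  have "c = 1 # 0 # rev w" using c_w by (metis append_Cons append_Nil rev.simps(2) rev_append rev_c rev_singleton_conv)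
  moreover have "c = block (Suc k) @ rest"
    unfolding c_eq rest_def by (subst upt_m(2)) (simp add: k)
  ultimately have "1 # rev w = block k @ rest" by (simp add: block_def)
  moreover have "map (\<lambda>i. e (i + m)) [0..<m] = k # map e [Suc 0..<m]"
    by (subst upt_m(2)) (simp add: e_m k per)
  ultimately have u: "1 # rev w = block_word (map (\<lambda>i. e (i + m)) [0..<m])"
    by (simp add: rest_def)
  have "has_blocks (\<lambda>i. e (i + m)) p"
    unfolding p_def u by (rule has_blocks_iter[OF Q(4)]) (simp add: per Q(4))
  from has_blocks_conc[OF this] show ?thesis by (simp add: rhe_eq c_eq)
qed

section \<open>Sequences between \<open>lhe q\<close> and \<open>rhe q\<close>\<close>

lemma p_unroll: "p = (1 # rev w) \<frown> p"
  unfolding p_def by (rule iter_unroll) simp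

lemma lhe_unroll: "lhe q = (w @ [1]) \<frown> lhe q"
  unfolding lhe_def w_def by (rule iter_unroll) simp

lemma even_w1: "even_word (w @ [1])" "even_word (1 # rev w)"
  using odd_w by simp_all

lemma not_le_rhe_w00: "\<not> (w \<frown> (0 ## (0 ## x))) \<preceq>\<^sub>u rhe q"
  using odd_w by (simp add: not_uni_le_iff rhe_eq c_w uni_less_conc flip: conc_conc)

text \<open>The sequences separate right after the odd word \<open>w\<close>, where the symbol 1
  gives the smaller one.\<close>

lemma lhe_less_c: "lhe q \<prec>\<^sub>u (c \<frown> x)"
proof -
  have "lhe q = w \<frown> (1 ## lhe q)" using lhe_unroll by simp
  moreover have "(w \<frown> (1 ## lhe q)) \<prec>\<^sub>u (c \<frown> x)"
    using odd_w by (simp add: c_w uni_less_conc flip: conc_conc)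
  ultimately show ?thesis by simp
qed

text \<open>Both bounds begin with \<open>w\<close>. After it a 1 gives the first case and 01 the
  second; 00 would exceed \<open>rhe q\<close>.\<close>

lemma between_cases:
  assumes "lhe q \<preceq>\<^sub>u s" "s \<preceq>\<^sub>u rhe q"
  obtains s' where "s = (w @ [1]) \<frown> s'" | s' where "s = c \<frown> s'"
proof -
  have "lhe q = w \<frown> (1 ## lhe q)" "rhe q = w \<frown> (0 ## (1 ## p))"
    using lhe_unroll by (simp_all add: rhe_eq c_w)
  then obtain s1 where s1: "s = w \<frown> s1" using assms uni_less_between_prefix by metis
  have b: "s1 = s1 0 ## (s1 1 ## suffix 2 s1)"
    using build_split[of s1] build_split[of "suffix 1 s1"] by (simp add: numeral_2_eq_2)
  show ?thesis
  proof (cases "s1 0")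
    case zero
    then have "s1 1 = 1" using assms(2) not_le_rhe_w00 b s1 by (metis bit_not_one_iff)
    then have "s = c \<frown> suffix 2 s1" using b zero s1 by (simp add: c_w)
    then show ?thesis using that by blast
  next
    case one
    then have "s = (w @ [1]) \<frown> (s1 1 ## suffix 2 s1)" using b s1 by simp
    then show ?thesis using that by blast
  qed
qed

text \<open>Suppose \<open>k\<close> began with \<open>w @ [1]\<close>. Any shift above
  \<open>lhe q\<close> lies between \<open>lhe q\<close> and \<open>k\<close>, so it begins with
  \<open>w @ [1]\<close> too. Removing this even word leaves a shift above \<open>lhe q\<close> with
  an earlier first difference, and the descent is contradictory.\<close>

lemma maximal_prefix:
  assumes "lhe q \<preceq>\<^sub>u k" "k \<preceq>\<^sub>u rhe q" "k \<noteq> lhe q" "k \<noteq> rhe q" and shift: "\<And>i. suffix i k \<preceq>\<^sub>u k"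
  obtains y where "k = c \<frown> y" "y \<prec>\<^sub>u p" "y = suffix (n + 1) k"
proof -
  have less: "lhe q \<prec>\<^sub>u k" "k \<prec>\<^sub>u rhe q" using assms by (auto simp: uni_le_def)
  consider k1 where "k = (w @ [1]) \<frown> k1" | y where "k = c \<frown> y" using between_cases assms(1,2) by blast
  then show ?thesis
  proof cases
    case (1 k1)
    have "False" if "first_diff r s (lhe q)" "lhe q \<prec>\<^sub>u s" "s = suffix i k" for r s i
      using that
    proof (induction r arbitrary: s i rule: less_induct)
      case (less r)
      have "(w @ [1]) \<frown> lhe q \<preceq>\<^sub>u s" "s \<preceq>\<^sub>u (w @ [1]) \<frown> k1"
        using less.prems(2,3) lhe_unroll shift 1 by (metis uni_le_def)+
      then obtain s' where s': "s = (w @ [1]) \<frown> s'" using uni_less_between_prefix by blast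
      have "first_diff r ((w @ [1]) \<frown> s') ((w @ [1]) \<frown> lhe q)"
        using less.prems(1) lhe_unroll s' by metis
      from first_diff_concD[OF this]
      have "r - length (w @ [1]) < r" "first_diff (r - length (w @ [1])) s' (lhe q)" by auto
      moreover have "lhe q \<prec>\<^sub>u s'" using less.prems(2) lhe_unroll s' uni_less_conc even_w1(1) by metis
      moreover have "s' = suffix (i + length (w @ [1])) k"
        using less.prems(3) s' suffix_conc_length suffix_suffix by metis
      ultimately show False using less.IH by blast
    qed
    moreover obtain r where "first_diff r k (lhe q)" using first_diff_exists assms(3) by blast
    ultimately have False using less(1) suffix_0 by metis
    then show ?thesis by blast
  next
    case (2 y)
    have "y \<prec>\<^sub>u p" using less(2) unfolding 2 rhe_eq by (simp add: uni_less_conc even_c)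
    moreover have "y = suffix (n + 1) k" unfolding 2 length_c[symmetric] by simp
    ultimately show ?thesis using that 2 by blast
  qed
qed

section \<open>Exchanging forward and backward conditions\<close>

lemma rev_c_fwd:
  assumes "bwd (bishift r S) = c \<frown> x"
  shows "fwd (bishift (r - int (n + 1)) S) = c \<frown> fwd (bishift r S)"
  using bwd_conc(1)[OF assms] by (simp only: rev_c length_c)

text \<open>A forward sequence above \<open>k\<close> would be \<open>c \<frown> t\<close> with
  \<open>t\<close> above \<open>y\<close>. Moving past the palindrome \<open>c\<close> gives a
  backward sequence that begins with \<open>c\<close> and hence exceeds
  \<open>lhe q\<close>.\<close>

lemma fwd_le_kneading:
  assumes k: "k = c \<frown> y" "y \<prec>\<^sub>u p"
    and a: "\<And>r. bwd (bishift r S) \<preceq>\<^sub>u rhe q"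
    and b: "\<And>r. y \<prec>\<^sub>u fwd (bishift r S) \<Longrightarrow> bwd (bishift r S) \<preceq>\<^sub>u lhe q"
    and ends: "\<not> ends_zeros S"
  shows "fwd (bishift r S) \<preceq>\<^sub>u k"
proof (rule ccontr)
  assume "\<not> ?thesis"
  then have less: "k \<prec>\<^sub>u fwd (bishift r S)" by (simp add: not_uni_le_iff)
  have "fwd (bishift r S) \<preceq>\<^sub>u rhe q"
    using fwd_le_if_bwd_le[OF E has_blocks_rhe[unfolded e_def] a ends] .
  with less obtain t where t: "fwd (bishift r S) = c \<frown> t"
    using uni_less_between_prefix[of c y _ p] k(1) rhe_eq uni_le_def by metis
  have "y \<prec>\<^sub>u t" using less unfolding t k(1) by (simp add: uni_less_conc even_c)
  then have "bwd (bishift (r + int (length c)) S) \<preceq>\<^sub>u lhe q" using b fwd_conc(2)[OF t] by simp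
  moreover have "bwd (bishift (r + int (length c)) S) = c \<frown> bwd (bishift r S)"
    using fwd_conc(1)[OF t] rev_c by simp
  ultimately show False using lhe_less_c not_uni_less_iff by metis
qed

lemma bwd_le_rhe:
  assumes k: "k = c \<frown> y" "y \<prec>\<^sub>u p"
    and fwd: "\<And>r. fwd (bishift r S) \<preceq>\<^sub>u k"
    and ends: "\<And>r. \<exists>i\<le>r. S i = 1"
  shows "bwd (bishift r S) \<preceq>\<^sub>u rhe q"
proof (rule bwd_le_if_fwd_le[OF E has_blocks_rhe[unfolded e_def] _ ends])
  have "k \<prec>\<^sub>u rhe q" using k by (simp add: rhe_eq uni_less_conc even_c)
  then show "fwd (bishift r S) \<preceq>\<^sub>u rhe q" for r
    using fwd[of r] uni_le_less_trans uni_le_def by blast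
qed

text \<open>
  If \<open>bwd\<close> exceeds \<open>lhe q\<close>, then it reads \<open>(w 1)^j c \<dots>\<close> for some \<open>j\<close>, so that \<open>c (1 rev w)^j\<close>
  precedes the forward sequence \<open>t\<close>. Prepending \<open>1 rev w\<close> keeps sequences above \<open>y\<close>, because
  it moves those below \<open>p\<close> upwards.
\<close>

lemma bwd_le_lhe:
  assumes k: "k = c \<frown> y" "y \<prec>\<^sub>u p"
    and fwd: "\<And>r. fwd (bishift r S) \<preceq>\<^sub>u k"
    and ends: "\<And>r. \<exists>i\<le>r. S i = 1"
    and y: "y \<prec>\<^sub>u fwd (bishift r S)"
  shows "bwd (bishift r S) \<preceq>\<^sub>u lhe q"
proof (rule ccontr)
  assume "\<not> ?thesis"
  then have less: "lhe q \<prec>\<^sub>u bwd (bishift r S)" by (simp add: not_uni_le_iff)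
  then obtain d where "first_diff d (bwd (bishift r S)) (lhe q)"
    using first_diff_exists uni_less_irrefl by metis
  then show False using less y
  proof (induction d arbitrary: r rule: less_induct)
    case (less d)
    let ?v = "bwd (bishift r S)" and ?t = "fwd (bishift r S)"
    have "lhe q \<preceq>\<^sub>u ?v" "?v \<preceq>\<^sub>u rhe q"
      using less.prems(2) bwd_le_rhe[OF k fwd ends] by (auto simp: uni_le_def)
    then consider v' where "?v = (w @ [1]) \<frown> v'" | v' where "?v = c \<frown> v'"
      using between_cases by metis
    then show False
    proof cases
      case (1 v')
      have "first_diff d ((w @ [1]) \<frown> v') ((w @ [1]) \<frown> lhe q)"
        using less.prems(1) lhe_unroll 1 by metis
      from first_diff_concD[OF this]
      have "d - length (w @ [1]) < d" "first_diff (d - length (w @ [1])) v' (lhe q)" by auto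
      moreover have "lhe q \<prec>\<^sub>u v'" using less.prems(2) lhe_unroll 1 uni_less_conc even_w1(1) by metis
      moreover have "y \<prec>\<^sub>u ((1 # rev w) \<frown> ?t)"
      proof (cases "?t \<prec>\<^sub>u p")
        case True
        then show ?thesis
          using less_conc_self[OF _ even_w1(2) p_unroll] less.prems(3) uni_less_trans by blast
      next
        case False
        then have "((1 # rev w) \<frown> p) \<preceq>\<^sub>u ((1 # rev w) \<frown> ?t)"
          using uni_le_conc_even even_w1(2) not_uni_less_iff by blast
        then show ?thesis using k(2) p_unroll uni_less_le_trans by metis
      qed
      moreover have "fwd (bishift (r - int (length (w @ [1]))) S) = (1 # rev w) \<frown> ?t"
        "bwd (bishift (r - int (length (w @ [1]))) S) = v'"
        using bwd_conc[OF 1] by simp_all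
      ultimately show False using less.IH by metis
    next
      case (2 v')
      \<comment> \<open>The past begins with \<open>c\<close>, so the forward sequence
        \<open>n + 1\<close> places earlier is \<open>c \<frown> ?t\<close>, which would exceed
        \<open>k\<close>.\<close>
      have "(c \<frown> ?t) \<preceq>\<^sub>u (c \<frown> y)" using rev_c_fwd[OF 2] fwd k(1) by metis
      then show False using less.prems(3) uni_le_conc_even even_c not_uni_less_iff by metis
    qed
  qed
qed

end

section \<open>Tent maps\<close>

text \<open>The slope on the branch with symbol \<open>s\<close> is \<open>sg s * l\<close>.\<close>

definition sg :: "bit \<Rightarrow> real" where
  "sg s = (if s = 0 then 1 else - 1)"

locale tent =
  fixes f :: "real \<Rightarrow> real" and a b c l :: real
  assumes tent: "tent_map f a b c l" and l_gt: "sqrt 2 < l" and l_less: "l < 2"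
begin

section \<open>Affine branches, and points determined by symbol sequences\<close>

abbreviation "\<kappa> \<equiv> kneading f a b c"

lemma abc: "a < c" "c < b"
  using tent by (auto simp: tent_map_def)

lemma l_gt_1: "1 < l"
proof -
  have "1 < sqrt 2" by simp
  then show ?thesis using l_gt by linarith
qed

lemma f_c: "f c = b" and f_b: "f b = a"
  using tent by (auto simp: tent_map_def)

lemma f_in: "x \<in> {a..b} \<Longrightarrow> f x \<in> {a..b}"
  using tent unfolding tent_map_def by blast

lemma funpow_in: "x \<in> {a..b} \<Longrightarrow> (f ^^ r) x \<in> {a..b}"
  by (induction r) (use f_in in auto)

lemma f_left:
  assumes "a \<le> x" "x \<le> c"
  shows "f x = b - l * (c - x)"
proof -
  have "\<forall>x\<in>{a..c}. \<forall>y\<in>{a..c}. f y - f x = l * (y - x)" using tent by (simp add: tent_map_def)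
  then have "f c - f x = l * (c - x)" using assms abc by (meson atLeastAtMost_iff less_eq_real_def)
  then show ?thesis using f_c by simp
qed

lemma f_right:
  assumes "c \<le> x" "x \<le> b"
  shows "f x = b - l * (x - c)"
proof -
  have "\<forall>x\<in>{c..b}. \<forall>y\<in>{c..b}. f y - f x = - l * (y - x)" using tent by (simp add: tent_map_def)
  then have "f x - f c = - l * (x - c)" using assms abc by (meson atLeastAtMost_iff less_eq_real_def)
  then show ?thesis using f_c by simp
qed

lemma a_eq: "a = b - l * (b - c)"
  using f_right[of b] f_b abc by simp

text \<open>Here \<open>l < 2\<close> enters. It places the fixed point of the left branch to the
  left of \<open>a\<close> and keeps left images of points of \<open>[a,c]\<close> above
  \<open>a\<close>.\<close>

lemma ca_less: "c - a < b - c"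
proof -
  have "l * (b - c) < 2 * (b - c)" using l_less abc by (intro mult_strict_right_mono) simp_all
  then show ?thesis using a_eq by (simp add: algebra_simps)
qed

lemma f_eq_b:
  assumes "x \<in> {a..b}" "f x = b"
  shows "x = c"
proof -
  have "l * (c - x) = 0 \<or> l * (x - c) = 0"
    using f_left[of x] f_right[of x] assms by (cases "x \<le> c") simp_all
  then show ?thesis using l_gt_1 by auto
qed

text \<open>Each point is the preimage of the next under the affine branch named by the symbol. The
  branches are extended to all reals, so the points are not forced into
  \<open>[a,b]\<close>.\<close>

definition coded :: "bit word \<Rightarrow> (nat \<Rightarrow> real) \<Rightarrow> bool" where
  "coded s x \<longleftrightarrow> (\<forall>r. x r = c - sg (s r) * (b - x (Suc r)) / l)"

lemma codedD: "coded s x \<Longrightarrow> x r = c - sg (s r) * (b - x (Suc r)) / l"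
  unfolding coded_def by (rule spec)

lemma coded_diff:
  assumes "coded s x" "coded t y" "\<And>i. i < r \<Longrightarrow> s i = t i"
  shows "x 0 - y 0 = (if even_word (prefix r s) then 1 else - 1) * (x r - y r) / l ^ r"
  using assms(3)
proof (induction r)
  case (Suc r)
  have "x r = c - sg (s r) * (b - x (Suc r)) / l" "y r = c - sg (s r) * (b - y (Suc r)) / l"
    using codedD[OF assms(1), of r] codedD[OF assms(2), of r] Suc.prems[of r] by simp_all
  then have *: "x r - y r = sg (s r) * (x (Suc r) - y (Suc r)) / l"
    by (simp add: right_diff_distrib diff_divide_distrib)
  have "x 0 - y 0 = (if even_word (prefix r s) then 1 else - 1) * (x r - y r) / l ^ r"
    using Suc by simp
  then show ?case unfolding * by (cases "s r") (auto simp: sg_def even_word_def)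
qed simp

text \<open>Inverse branches contract by \<open>1 / l\<close>, so a bounded difference at time
  \<open>r\<close> shrinks to at most \<open>K / l ^ r\<close> at time 0.\<close>

lemma coded_unique:
  assumes "coded s x" "coded s y" "\<And>r. \<bar>x r - y r\<bar> \<le> K"
  shows "x 0 = y 0"
proof (rule ccontr)
  assume "x 0 \<noteq> y 0"
  then have d: "0 < \<bar>x 0 - y 0\<bar>" by simp
  obtain r where "K / \<bar>x 0 - y 0\<bar> < l ^ r" using real_arch_pow l_gt_1 by blast
  moreover have "0 < l ^ r" using l_gt_1 by simp
  ultimately have "K / l ^ r < \<bar>x 0 - y 0\<bar>" using d by (simp only: divide_less_eq if_True mult.commute)
  also have "\<bar>x 0 - y 0\<bar> = \<bar>x r - y r\<bar> / l ^ r"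
    using coded_diff[OF assms(1,2), of r] l_gt_1 by (auto simp: abs_minus_commute)
  also have "\<dots> \<le> K / l ^ r" using assms(3) l_gt_1 by (intro divide_right_mono) auto
  finally show False by simp
qed

text \<open>At the first difference the two branches have opposite signs, so the distances below
  \<open>b\<close> add up; parity fixes the sign of the total. Points whose orbits stay below
  \<open>b\<close> are thus weakly ordered like their codes.\<close>

lemma coded_less:
  assumes "coded s x" "coded t y" "s \<prec>\<^sub>u t"
  obtains r where "first_diff r s t" "y 0 - x 0 = ((b - x (Suc r)) + (b - y (Suc r))) / l ^ Suc r"
proof -
  obtain r where r: "first_diff r s t" "even_word (prefix (Suc r) s)"
    using assms(3) uni_less_iff by blast
  have st: "s r \<noteq> t r" "\<And>i. i < r \<Longrightarrow> s i = t i" using r(1) by (auto simp: first_diff_def)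
  have xy: "x r = c - sg (s r) * (b - x (Suc r)) / l" "y r = c - sg (t r) * (b - y (Suc r)) / l"
    by (rule codedD[OF assms(1)], rule codedD[OF assms(2)])
  have "x 0 - y 0 = (if even_word (prefix r s) then 1 else - 1) * (x r - y r) / l ^ r"
    by (rule coded_diff[OF assms(1,2) st(2)])
  moreover have "(if even_word (prefix r s) then 1 else - 1) * (x r - y r)
      = - ((b - x (Suc r)) + (b - y (Suc r))) / l"
  proof (cases "s r")
    case zero
    then have "t r = 1" "even_word (prefix r s)" using st(1) r(2) by (auto simp: even_word_def)
    then show ?thesis unfolding xy using zero by (simp add: sg_def add_divide_distrib diff_divide_distrib)
  next
    case one
    then have "t r = 0" "\<not> even_word (prefix r s)" using st(1) r(2) by (auto simp: even_word_def)
    then show ?thesis unfolding xy using one by (simp add: sg_def add_divide_distrib diff_divide_distrib)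
  qed
  ultimately have "x 0 - y 0 = - ((b - x (Suc r)) + (b - y (Suc r))) / l / l ^ r"
    by (simp only:)
  then have "x 0 - y 0 = - (((b - x (Suc r)) + (b - y (Suc r))) / l ^ Suc r)"
    by (simp only: divide_divide_eq_left power_Suc minus_divide_left)
  then have "y 0 - x 0 = ((b - x (Suc r)) + (b - y (Suc r))) / l ^ Suc r" by linarith
  then show ?thesis using that r(1) by blast
qed

text \<open>The solution of \<open>x s = c - sg (s 0) * (b - x (suffix 1 s)) / l\<close> that is bounded in \<open>s\<close>.\<close>

definition code_point :: "bit word \<Rightarrow> real" where
  "code_point s = c - (b - c) * (\<Sum>k. \<Prod>j\<le>k. sg (s j) / l)"

lemma abs_code_term: "\<bar>\<Prod>j\<le>k. sg (s j) / l\<bar> = (1 / l) * (1 / l) ^ k"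
proof -
  have "\<bar>\<Prod>j\<le>k. sg (s j) / l\<bar> = (\<Prod>j\<le>k. 1 / l)"
    unfolding abs_prod using l_gt_1 by (intro prod.cong) (auto simp: sg_def)
  then show ?thesis by simp
qed

lemma summable_abs_code: "summable (\<lambda>k. \<bar>\<Prod>j\<le>k. sg (s j) / l\<bar>)"
  unfolding abs_code_term using l_gt_1 by (intro summable_mult summable_geometric) simp

lemmas summable_code = summable_rabs_cancel[OF summable_abs_code]

lemma coded_code_point: "coded s (\<lambda>r. code_point (suffix r s))"
  unfolding coded_def
proof
  fix r
  have "code_point t = c - sg (t 0) * (b - code_point (suffix 1 t)) / l" for t
  proof -
    define A where "A = (\<Sum>k. \<Prod>j\<le>k. sg (suffix 1 t j) / l)"
    have "(\<Prod>j\<le>Suc k. sg (t j) / l) = sg (t 0) / l * (\<Prod>j\<le>k. sg (suffix 1 t j) / l)" for k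
      by (subst prod.atMost_Suc_shift) simp
    then have "(\<Sum>k. \<Prod>j\<le>Suc k. sg (t j) / l) = sg (t 0) / l * A"
      unfolding A_def by (simp only: suminf_mult[OF summable_code])
    then have *: "(\<Sum>k. \<Prod>j\<le>k. sg (t j) / l) = sg (t 0) / l * A + sg (t 0) / l"
      using suminf_split_head[OF summable_code[of t]] by simp
    have "code_point (suffix 1 t) = c - (b - c) * A" by (simp add: code_point_def A_def)
    then have "b - code_point (suffix 1 t) = (b - c) * (1 + A)" by (simp add: algebra_simps)
    moreover have "(b - c) * (sg (t 0) / l * A + sg (t 0) / l) = sg (t 0) * ((b - c) * (1 + A)) / l"
      using l_gt_1 by (simp add: field_simps)
    ultimately show ?thesis unfolding code_point_def[of t] * by simp
  qed
  from this[of "suffix r s"]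
  show "code_point (suffix r s) = c - sg (s r) * (b - code_point (suffix (Suc r) s)) / l" by simp
qed

lemma code_point_bounded: obtains K where "0 \<le> K" "\<And>s. \<bar>code_point s\<bar> \<le> K"
proof -
  define A where "A = (\<Sum>k. (1 / l) * (1 / l) ^ k)"
  have "\<bar>code_point s\<bar> \<le> \<bar>c\<bar> + (b - c) * A" for s
  proof -
    have "\<bar>\<Sum>k. \<Prod>j\<le>k. sg (s j) / l\<bar> \<le> A"
      using summable_rabs[OF summable_abs_code[of s]] unfolding abs_code_term A_def .
    then have "\<bar>(b - c) * (\<Sum>k. \<Prod>j\<le>k. sg (s j) / l)\<bar> \<le> (b - c) * A"
      using abc by (simp add: abs_mult mult_left_mono)
    then show ?thesis unfolding code_point_def by linarith
  qed
  moreover from this have "0 \<le> \<bar>c\<bar> + (b - c) * A" using abs_ge_zero order_trans by blast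
  ultimately show ?thesis using that by blast
qed

section \<open>Itineraries and the kneading sequence\<close>

lemma admissible_sides:
  assumes "admissible_symbol f a b c x s" "x \<in> {a..b}"
  shows "s = 0 \<Longrightarrow> x \<le> c" "s = 1 \<Longrightarrow> c \<le> x"
  using assms unfolding admissible_symbol_def by (auto split: if_splits simp: not_le[symmetric])

lemma itinerary_sides:
  assumes "is_itinerary f a b c x s" "x \<in> {a..b}"
  shows "s r = 0 \<Longrightarrow> (f ^^ r) x \<le> c" "s r = 1 \<Longrightarrow> c \<le> (f ^^ r) x"
  using admissible_sides funpow_in assms unfolding is_itinerary_def by blast+

lemma coded_itinerary:
  assumes "is_itinerary f a b c x s" "x \<in> {a..b}"
  shows "coded s (\<lambda>r. (f ^^ r) x)"
  unfolding coded_def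
proof
  fix r
  have *: "(f ^^ r) x \<in> {a..b}" using funpow_in assms by blast
  show "(f ^^ r) x = c - sg (s r) * (b - (f ^^ Suc r) x) / l"
    using itinerary_sides[OF assms, of r] f_left[of "(f ^^ r) x"] f_right[of "(f ^^ r) x"] * l_gt_1
    by (cases "s r") (auto simp: sg_def field_simps)
qed

lemma orbit_c: "(f ^^ r) b = (f ^^ Suc r) c"
  by (simp add: funpow_swap1 f_c)

lemma admissible_ex: "x \<in> {a..b} \<Longrightarrow> \<exists>s. admissible_symbol f a b c x s"
  unfolding admissible_symbol_def
  by (cases "x < c"; cases "x = c"; cases "periodic_point f c")
    (auto intro: exI[of _ 0] exI[of _ 1])

lemma admissible_unique:
  assumes "x \<in> {a..b}" "admissible_symbol f a b c x s" "admissible_symbol f a b c x t"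
    "periodic_point f c \<or> x \<noteq> c"
  shows "s = t"
  using assms unfolding admissible_symbol_def
  by (cases s; cases t; cases "x < c"; cases "x = c") (auto split: if_splits)

text \<open>The orbit of \<open>b = f c\<close> meets \<open>c\<close> only if \<open>c\<close> is
  periodic, so every symbol is forced.\<close>

lemma itinerary_b_unique:
  assumes "is_itinerary f a b c b s" "is_itinerary f a b c b t"
  shows "s = t"
proof
  fix r
  have "periodic_point f c \<or> (f ^^ r) b \<noteq> c"
    unfolding orbit_c periodic_point_def by blast
  then show "s r = t r"
    using admissible_unique[OF funpow_in, of b r] assms abc by (auto simp: is_itinerary_def)
qed

lemma itinerary_kneading: "is_itinerary f a b c b \<kappa>"
proof -
  have "\<forall>r. \<exists>s. admissible_symbol f a b c ((f ^^ r) b) s"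
    using admissible_ex funpow_in abc by simp
  then have "\<exists>s. is_itinerary f a b c b s" unfolding is_itinerary_def by (rule choice)
  then have "\<exists>!s. is_itinerary f a b c b s" using itinerary_b_unique by blast
  then show ?thesis unfolding kneading_def by (rule theI')
qed

lemmas coded_kneading = coded_itinerary[OF itinerary_kneading]

lemma b_in: "b \<in> {a..b}"
  using abc by simp

text \<open>If \<open>s\<close> exceeded the kneading sequence, \<open>coded_less\<close> would give
  \<open>b \<le> x\<close>; then \<open>x = b\<close>, whose itinerary is unique.\<close>

lemma itinerary_le_kneading:
  assumes "is_itinerary f a b c x s" "x \<in> {a..b}"
  shows "s \<preceq>\<^sub>u \<kappa>"
proof (rule ccontr)
  assume "\<not> ?thesis"
  then have less: "\<kappa> \<prec>\<^sub>u s" by (simp add: not_uni_le_iff)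
  obtain r where "x - b = ((b - (f ^^ Suc r) b) + (b - (f ^^ Suc r) x)) / l ^ Suc r"
    using coded_less[OF coded_kneading[OF b_in] coded_itinerary[OF assms] less] by auto
  moreover have "(f ^^ Suc r) b \<le> b" "(f ^^ Suc r) x \<le> b"
    using funpow_in[OF b_in, of "Suc r"] funpow_in[OF assms(2), of "Suc r"] by simp_all
  ultimately have "0 \<le> x - b" using l_gt_1 by simp
  then have "x = b" using assms(2) by simp
  then have "s = \<kappa>" using assms(1) itinerary_b_unique itinerary_kneading by blast
  then show False using less by simp
qed

lemma suffix_itinerary: "is_itinerary f a b c x s \<Longrightarrow> is_itinerary f a b c ((f ^^ k) x) (suffix k s)"
  unfolding is_itinerary_def by (metis add.commute comp_apply funpow_add suffix_nth)

lemma suffix_kneading_le: "suffix k \<kappa> \<preceq>\<^sub>u \<kappa>"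
  using itinerary_le_kneading[OF suffix_itinerary[OF itinerary_kneading] funpow_in[OF b_in]] .

text \<open>The left branch expands away from its fixed point, which lies to the left of \<open>a\<close>.\<close>

lemma itinerary_has_one:
  obtains N where "\<And>x s. is_itinerary f a b c x s \<Longrightarrow> x \<in> {a..b} \<Longrightarrow> \<exists>i<N. s i = 1"
proof -
  define p where "p = (l * c - b) / (l - 1)"
  have p: "p * (l - 1) = l * c - b" using l_gt_1 by (simp add: p_def)
  have "l * (c - a) < l * (b - c)" using ca_less l_gt_1 by simp
  then have "l * c - l * a < l * b - l * c" by (simp add: right_diff_distrib)
  moreover have "a = b - l * b + l * c" using a_eq by (simp add: right_diff_distrib)
  ultimately have "l * c - b < l * a - a" by linarith
  then have "l * c - b < a * (l - 1)" by (simp add: algebra_simps)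
  then have pa: "p < a" using p l_gt_1 by (metis diff_gt_0_iff_gt mult_less_cancel_right_pos)
  \<comment> \<open>After \<open>N\<close> steps on the left branch even the smallest initial
    distance \<open>a - p\<close> would exceed \<open>b - p\<close>.\<close>
  obtain N where N: "(b - p) / (a - p) < l ^ N" using real_arch_pow l_gt_1 by blast
  have "\<exists>i<N. s i = 1" if it: "is_itinerary f a b c x s" and x: "x \<in> {a..b}" for x s
  proof (rule ccontr)
    assume "\<not> ?thesis"
    then have zero: "s i = 0" if "i < N" for i using that by auto
    have "(f ^^ k) x - p = l ^ k * (x - p)" if "k \<le> N" for k
      using that
    proof (induction k)
      case (Suc k)
      have "(f ^^ k) x \<le> c" using itinerary_sides(1)[OF it x] zero[of k] Suc.prems by simp
      then have "f ((f ^^ k) x) = b - l * (c - (f ^^ k) x)" using f_left funpow_in[OF x, of k] by simp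
      also have "\<dots> - p = l * ((f ^^ k) x - p)" using p by (simp add: algebra_simps)
      finally show ?case using Suc by simp
    qed simp
    from this[of N] have "l ^ N * (x - p) \<le> b - p" using funpow_in[OF x, of N] by simp
    moreover have "l ^ N * (a - p) \<le> l ^ N * (x - p)" using x l_gt_1 by (intro mult_left_mono) auto
    ultimately show False using N pa by (simp add: divide_less_eq)
  qed
  then show ?thesis using that by blast
qed

lemma code_point_kneading: "code_point \<kappa> = b"
proof -
  obtain K where K: "\<And>s. \<bar>code_point s\<bar> \<le> K" using code_point_bounded by blast
  have "\<bar>code_point (suffix r \<kappa>) - (f ^^ r) b\<bar> \<le> K + \<bar>a\<bar> + \<bar>b\<bar>" for r
    using K[of "suffix r \<kappa>"] funpow_in[OF b_in, of r] by (simp add: abs_if split: if_splits)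
  from coded_unique[OF coded_code_point coded_kneading[OF b_in] this] show ?thesis by simp
qed

lemma code_point_le:
  assumes "\<And>r. suffix r s \<preceq>\<^sub>u \<kappa>"
  shows "code_point s \<le> b"
proof (rule ccontr)
  assume "\<not> ?thesis"
  then have gt: "0 < code_point s - b" by simp
  obtain K where K: "0 \<le> K" "\<And>s. \<bar>code_point s\<bar> \<le> K" using code_point_bounded by blast
  define M where "M = K + \<bar>b\<bar>"
  have M: "0 \<le> M" using K by (simp add: M_def)
  \<comment> \<open>The bound covers all admissible \<open>s\<close> at once, because the step for
    \<open>s\<close> uses it for a shift of \<open>s\<close>.\<close>
  have "code_point s - b \<le> M / l ^ k" if "\<And>r. suffix r s \<preceq>\<^sub>u \<kappa>" for k s
    using that
  proof (induction k arbitrary: s)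
    case 0
    show ?case using K(2)[of s] by (simp add: M_def abs_if split: if_splits)
  next
    case (Suc k)
    show ?case
    proof (cases "s = \<kappa>")
      case True
      then show ?thesis using code_point_kneading M l_gt_1 by simp
    next
      case False
      then have "s \<prec>\<^sub>u \<kappa>" using Suc.prems[of 0] by (simp add: uni_le_def)
      then obtain r where r: "b - code_point s
          = ((b - code_point (suffix (Suc r) s)) + (b - (f ^^ Suc r) b)) / l ^ Suc r"
        using coded_less[OF coded_code_point coded_kneading[OF b_in]] by (metis funpow_0 suffix_0)
      have "code_point (suffix (Suc r) s) - b \<le> M / l ^ k"
        using Suc.prems by (intro Suc.IH) (simp only: suffix_suffix)
      moreover have "(f ^^ Suc r) b \<le> b" using funpow_in[OF b_in, of "Suc r"] by simp
      ultimately have "- (M / l ^ k) / l ^ Suc r \<le> b - code_point s"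
        unfolding r using l_gt_1 by (intro divide_right_mono) auto
      moreover have "M / l ^ k / l ^ Suc r \<le> M / l ^ k / l"
        using M l_gt_1 self_le_power[of l "Suc r"] by (intro divide_left_mono) auto
      moreover have "- (M / l ^ k) / l ^ Suc r = - (M / l ^ k / l ^ Suc r)"
        "M / l ^ k / l = M / l ^ Suc k" by simp_all
      ultimately show ?thesis by linarith
    qed
  qed
  then have *: "code_point s - b \<le> M / l ^ k" for k using assms by blast
  obtain k where "M / (code_point s - b) < l ^ k" using real_arch_pow l_gt_1 by blast
  moreover have "0 < l ^ k" using l_gt_1 by simp
  ultimately have "M / l ^ k < code_point s - b"
    using gt by (simp only: divide_less_eq if_True mult.commute)
  then show False using *[of k] by simp
qed

section \<open>The parity convention at a periodic turning point\<close>

lemma even_word_prefix_card: "even_word (prefix d s) \<longleftrightarrow> even (card {r. r < d \<and> s r = 1})"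
proof (induction d)
  case (Suc d)
  have "{r. r < Suc d \<and> s r = 1} = (if s d = 1 then insert d else id) {r. r < d \<and> s r = 1}"
    by (auto simp: less_Suc_eq)
  then show ?case using Suc by (cases "s d") auto
qed simp

text \<open>\<open>eps\<close> is chosen so that the word up to the first return to \<open>c\<close>
  is even: it completes the count of ones before. Later returns add further such words, since the
  kneading sequence repeats after the period.\<close>

lemma even_word_kneading_return:
  assumes per: "periodic_point f c" and "(f ^^ d) b = c"
  shows "even_word (prefix (Suc d) \<kappa>)"
  using assms(2)
proof (induction d rule: less_induct)
  case (less d)
  define p where "p = least_period f c"
  have p: "p > 0 \<and> (f ^^ p) c = c"
    using LeastI_ex[OF per[unfolded periodic_point_def]] unfolding p_def least_period_def .
  have least: "p \<le> j" if "j > 0" "(f ^^ j) c = c" for j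
    unfolding p_def least_period_def using that by (intro Least_le) simp
  have "p \<le> Suc d" using less.prems orbit_c least by simp
  then consider "Suc d = p" | "p \<le> d" by linarith
  then show ?case
  proof cases
    case 1
    have ne: "(f ^^ r) b \<noteq> c" if "r < d" for r
    proof
      assume "(f ^^ r) b = c"
      then have "p \<le> Suc r" using least[of "Suc r"] orbit_c[of r] by simp
      then show False using that 1 by simp
    qed
    have adm: "admissible_symbol f a b c ((f ^^ r) b) (\<kappa> r)" for r
      using itinerary_kneading by (simp add: is_itinerary_def)
    have in_ab: "(f ^^ r) b \<in> {a..b}" for r using funpow_in[OF b_in] .
    have one: "\<kappa> r = 1 \<longleftrightarrow> (f ^^ Suc r) c \<in> {c<..b}" if "r < d" for r
    proof -
      have "(f ^^ r) b < c \<Longrightarrow> \<kappa> r = 0" "c < (f ^^ r) b \<Longrightarrow> \<kappa> r = 1"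
        using adm[of r] in_ab[of r] per by (simp_all add: admissible_symbol_def)
      then show ?thesis using ne[OF that] in_ab[of r] unfolding orbit_c[symmetric]
        by (cases "(f ^^ r) b < c") simp_all
    qed
    have "{r. 1 \<le> r \<and> r < p \<and> (f ^^ r) c \<in> {c<..b}} = Suc ` {r. r < d \<and> \<kappa> r = 1}"
    proof (intro equalityI subsetI)
      fix r assume "r \<in> {r. 1 \<le> r \<and> r < p \<and> (f ^^ r) c \<in> {c<..b}}"
      moreover from this have "r = Suc (r - 1)" by simp
      ultimately show "r \<in> Suc ` {r. r < d \<and> \<kappa> r = 1}"
        using one[of "r - 1"] 1 by (intro image_eqI[of _ _ "r - 1"]) auto
    qed (use one 1 in auto)
    then have "eps f b c = (if even_word (prefix d \<kappa>) then 0 else 1)"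
      unfolding eps_def p_def[symmetric] even_word_prefix_card by (simp add: card_image)
    moreover have "\<kappa> d = eps f b c"
      using adm[of d] less.prems per abc by (simp add: admissible_symbol_def)
    ultimately show ?thesis by (simp add: even_word_def split: if_splits)
  next
    case 2
    have fpb: "(f ^^ p) b = b" using p orbit_c[of p] f_c by simp
    then have "is_itinerary f a b c b (suffix p \<kappa>)"
      using suffix_itinerary[OF itinerary_kneading, of p] by simp
    then have per_k: "suffix p \<kappa> = \<kappa>" using itinerary_b_unique itinerary_kneading by blast
    have "(f ^^ (d - p)) b = (f ^^ (d - p)) ((f ^^ p) b)" using fpb by simp
    also have "\<dots> = (f ^^ d) b" using 2 by (metis comp_apply funpow_add le_add_diff_inverse2)
    finally have "even_word (prefix (Suc (d - p)) \<kappa>)" using less p 2 by simp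
    moreover have "(f ^^ (p - 1)) b = c" using p orbit_c[of "p - 1"] by simp
    then have "even_word (prefix p \<kappa>)" using less.IH[of "p - 1"] p 2 by (auto simp del: subseq_to_Suc)
    moreover have "prefix (Suc d) \<kappa> = prefix p \<kappa> @ prefix (Suc (d - p)) (suffix p \<kappa>)"
      using subsequence_append[of \<kappa> p "Suc (d - p)"] subsequence_shift[of p \<kappa> 0 "Suc (d - p)"] 2
      by (simp del: subseq_to_Suc subsequence_shift)
    ultimately show ?thesis unfolding per_k by simp
  qed
qed

lemma kneading_0: "\<kappa> 0 = 1"
  using itinerary_sides(1)[OF itinerary_kneading b_in, of 0] abc by (cases "\<kappa> 0") auto

lemma kneading_1: "\<kappa> 1 = 0"
  using itinerary_sides(2)[OF itinerary_kneading b_in, of 1] abc f_b by (cases "\<kappa> 1") auto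

lemma height_kneading_pos: "0 < height \<kappa>"
proof -
  have "\<exists>i. suffix 1 \<kappa> i = 1"
    using itinerary_has_one suffix_itinerary[OF itinerary_kneading, of 1] funpow_in[OF b_in, of 1]
    by metis
  then obtain k s' where "suffix 1 \<kappa> = replicate k 0 \<frown> (1 ## s')" using split_at_one by blast
  then have "\<kappa> = 1 ## (replicate k 0 \<frown> (1 ## s'))"
    using build_split[of \<kappa>] kneading_0 by simp
  then show ?thesis by (rule height_pos)
qed

text \<open>
  For \<open>l > sqrt 2\<close> the point \<open>f a\<close> lies to the left of the fixed point of the right branch, whose
  itinerary is \<open>1^\<infinity>\<close>. Hence \<open>\<kappa>\<close> exceeds \<open>101^\<infinity> = rhe (1/2)\<close>.
\<close>

lemma height_kneading_less: "height \<kappa> < 1/2"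
proof -
  define ones :: "bit word" where "ones = (\<lambda>_. 1)"
  let ?k2 = "suffix 2 \<kappa>"
  have f2: "(f ^^ 2) b = f a" by (simp add: numeral_2_eq_2 f_b)
  have it: "is_itinerary f a b c (f a) ?k2"
    using suffix_itinerary[OF itinerary_kneading, of 2] f2 by simp
  have fa: "f a \<in> {a..b}" using f_in abc by simp
  define p where "p = (b + l * c) / (1 + l)"
  have p: "p * (1 + l) = b + l * c" using l_gt_1 by (simp add: p_def)
  have coded_p: "coded ones (\<lambda>_. p)"
    using p l_gt_1 by (simp add: coded_def ones_def sg_def field_simps)
  have bp: "p \<le> b" using p abc l_gt_1 by (simp add: p_def divide_le_eq algebra_simps)
  have "f a < p"
  proof -
    define u where "u = b - c"
    have b: "b = c + u" by (simp add: u_def)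
    have "0 < u" using abc by (simp add: u_def)
    have a: "a = c + u - l * u" using a_eq by (simp add: u_def)
    have "f a = b - l * (c - a)" using f_left[of a] abc by simp
    also have "\<dots> = c + u * (1 + l - l * l)" unfolding a b by (simp add: algebra_simps)
    finally have fa: "f a = c + u * (1 + l - l * l)" .
    have "2 < l\<^sup>2" using l_gt l_gt_1 by (metis abs_of_pos less_trans real_sqrt_abs real_sqrt_less_iff zero_less_one)
    \<comment> \<open>The product is 1 + 2l - l^3, which is below 1 as l^2 > 2.\<close>
    then have "(1 + l - l * l) * (1 + l) < 1" using l_gt_1
      by (simp add: algebra_simps power2_eq_square)
    then have "u * ((1 + l - l * l) * (1 + l)) < u * 1" using \<open>0 < u\<close> by (intro mult_strict_left_mono)
    then have "f a * (1 + l) < p * (1 + l)" unfolding fa p b by (simp add: algebra_simps)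
    then show ?thesis using l_gt_1 by simp
  qed
  have "?k2 \<prec>\<^sub>u ones"
  proof (rule ccontr)
    assume "\<not> ?thesis"
    then consider "ones = ?k2" | "ones \<prec>\<^sub>u ?k2" using uni_less_linear by blast
    then show False
    proof cases
      case 1
      have "\<bar>(f ^^ r) (f a) - p\<bar> \<le> \<bar>a\<bar> + \<bar>b\<bar> + \<bar>p\<bar>" for r
        using funpow_in[OF fa, of r] by (simp add: abs_if split: if_splits)
      from coded_unique[OF coded_itinerary[OF it fa] coded_p[unfolded 1] this]
      show False using \<open>f a < p\<close> by simp
    next
      case 2
      obtain r where "f a - p = ((b - p) + (b - (f ^^ Suc r) (f a))) / l ^ Suc r"
        using coded_less[OF coded_p coded_itinerary[OF it fa] 2] by auto
      moreover have "(f ^^ Suc r) (f a) \<le> b" using funpow_in[OF fa, of "Suc r"] by simp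
      ultimately have "0 \<le> f a - p" using bp l_gt_1 by simp
      then show False using \<open>f a < p\<close> by simp
    qed
  qed
  then have gr: "([1, 0] \<frown> ones) \<prec>\<^sub>u ([1, 0] \<frown> ?k2)" by (simp add: uni_less_conc)
  have "prefix 2 \<kappa> = [1, 0]"
    using kneading_0 kneading_1 by (simp add: numeral_2_eq_2)
  then have "[1, 0] \<frown> ?k2 = \<kappa>" using prefix_suffix[of \<kappa> 2] by (simp only:)
  with gr have less: "([1, 0] \<frown> ones) \<prec>\<^sub>u \<kappa>" by (simp only:)
  \<comment> \<open>The exponents are 1, 0, 0, ..., so the expansion is 101 11 11 ..., that is 1 0
    followed by ones only.\<close>
  let ?g = "gaps (upper_sum (1 / 2))"
  have us: "upper_sum (1 / 2) (Suc i) = 2 * i + 3" for i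
  proof -
    have "real (Suc i) / (1 / 2) = of_nat (2 * i + 2)" by simp
    then show ?thesis by (simp only: upper_sum_def floor_of_nat) simp
  qed
  have g: "?g 0 = 1" "?g (Suc i) = 0" for i
    by (simp_all add: gaps_def us)
  have "has_blocks (\<lambda>i. ?g (i + 1)) ((block_word (map (\<lambda>i. ?g (i + 1)) [0..<1]))\<^sup>\<omega>)"
    by (rule has_blocks_iter) (simp_all add: g)
  moreover have "(block_word (map (\<lambda>i. ?g (i + 1)) [0..<1]))\<^sup>\<omega> = ones"
  proof
    fix i :: nat
    have "i mod 2 < 2" by simp
    then have "[1, 1] ! (i mod 2) = (1 :: bit)" by (auto simp: less_2_cases_iff)
    then show "(block_word (map (\<lambda>i. ?g (i + 1)) [0..<1]))\<^sup>\<omega> i = ones i"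
      by (simp add: g block_def ones_def numeral_2_eq_2)
  qed
  ultimately have "has_blocks ?g (block_word (map ?g [0..<1]) \<frown> ones)"
    using has_blocks_conc by metis
  moreover have "block_word (map ?g [0..<1]) \<frown> ones = [1, 0] \<frown> ones"
  proof -
    have "1 ## ones = ones" using build_first[of ones] by (simp add: ones_def suffix_def)
    then show ?thesis by (simp add: g block_def)
  qed
  ultimately have "has_blocks (gaps (upper_sum (of_rat (1 / 2)))) ([1, 0] \<frown> ones)"
    by (simp add: of_rat_divide)
  from height_less[OF _ _ this less] show ?thesis by (simp add: of_rat_divide)
qed

section \<open>Itineraries of points of the inverse limit\<close>

lemma inverse_limit_itinerary:
  assumes "x \<in> inverse_limit f a b" "\<And>r. admissible_symbol f a b c (x r) (S r)"
  shows "is_itinerary f a b c (x r) (fwd (bishift r S))" "x r \<in> {a..b}" "f (x r) = x (r + 1)"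
proof -
  show *: "x r \<in> {a..b}" "f (x r) = x (r + 1)" for r
    using assms(1) by (auto simp: inverse_limit_def)
  have "(f ^^ k) (x r) = x (r + int k)" for k
    by (induction k) (simp_all add: * algebra_simps)
  then show "is_itinerary f a b c (x r) (fwd (bishift r S))"
    using assms(2) by (simp add: is_itinerary_def fwd_def bishift_def add.commute)
qed

text \<open>The coordinates are the code points of the forward sequences. The bound
  \<open>code_point_le\<close> puts each on the side of \<open>c\<close> named by its symbol, ones
  to the left keep them above \<open>a\<close>, and \<open>per\<close> settles the symbol at
  \<open>c\<close>.\<close>

lemma inverse_limit_itineraryI:
  assumes fwd: "\<And>r. fwd (bishift r S) \<preceq>\<^sub>u \<kappa>"
    and ends: "\<And>r. \<exists>i\<le>r. S i = 1"
    and per: "\<And>r. periodic_point f c \<Longrightarrow> fwd (bishift r S) = \<kappa> \<Longrightarrow> S (r - 1) = eps f b c"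
  shows "S \<in> inverse_limit_itineraries f a b c"
proof -
  define x where "x r = code_point (fwd (bishift r S))" for r
  have suffix_x: "code_point (suffix k (fwd (bishift r S))) = x (r + int k)" for k r
    by (simp add: x_def suffix_fwd)
  have coded_x: "coded (fwd (bishift r S)) (\<lambda>k. x (r + int k))" for r
    using coded_code_point[of "fwd (bishift r S)"] unfolding suffix_x .
  have x_eq: "x r = c - sg (S r) * (b - x (r + 1)) / l" for r
    using coded_x[of r, unfolded coded_def, rule_format, of 0] by (simp add: fwd_def bishift_def)
  have x_le: "x r \<le> b" for r
    unfolding x_def by (rule code_point_le) (simp add: suffix_fwd fwd)
  have left: "x r \<le> c" "x (r + 1) = b - l * (c - x r)" if "S r = 0" for r
  proof -
    have *: "x r = c - (b - x (r + 1)) / l" using x_eq[of r] that by (simp add: sg_def)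
    then show "x (r + 1) = b - l * (c - x r)" using l_gt_1 by (simp add: field_simps)
    show "x r \<le> c" using * x_le[of "r + 1"] l_gt_1 by simp
  qed
  have right: "c \<le> x r" "x (r + 1) = b - l * (x r - c)" if "S r = 1" for r
  proof -
    have *: "x r = c + (b - x (r + 1)) / l"
      using x_eq[of r] that by (simp add: sg_def diff_divide_distrib)
    then show "x (r + 1) = b - l * (x r - c)" using l_gt_1 by (simp add: field_simps)
    show "c \<le> x r" using * x_le[of "r + 1"] l_gt_1 by simp
  qed
  \<comment> \<open>A right branch sends points at most \<open>b\<close> to points at least
    \<open>a\<close>, and both branches preserve the lower bound afterwards. So start from a 1 to
    the left of \<open>r\<close>.\<close>
  have x_ge: "a \<le> x r" for r
  proof -
    have one: "a \<le> x (i + 1)" if "S i = 1" for i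
    proof -
      have "l * (x i - c) \<le> l * (b - c)" using x_le[of i] l_gt_1 by simp
      then show ?thesis using right(2)[OF that] a_eq by linarith
    qed
    have step: "a \<le> x (i + 1)" if "a \<le> x i" for i
    proof (cases "S i")
      case zero
      have "l * (c - x i) \<le> l * (b - c)" using that ca_less l_gt_1 by simp
      then show ?thesis using left(2)[OF zero] a_eq by linarith
    qed (rule one)
    obtain i where i: "i \<le> r - 1" "S i = 1" using ends by blast
    have "i + 1 \<le> r" using i by simp
    then show ?thesis by (induction r rule: int_ge_induct) (use one i step in auto)
  qed
  have f_x: "f (x r) = x (r + 1)" for r
    using left[of r] right[of r] f_left[of "x r"] f_right[of "x r"] x_le[of r] x_ge[of r]
    by (cases "S r") auto
  have S_c: "S r = eps f b c" if pc: "periodic_point f c" and "x r = c" for r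
  proof -
    let ?s = "fwd (bishift (r + 1) S)"
    have xb: "x (r + 1) = b" using f_x[of r] that f_c by simp
    \<comment> \<open>A point \<open>b\<close> with a smaller code would force the first difference
      to occur at a return to \<open>c\<close>, where the prefix of the kneading sequence is even; a
      smaller code makes that prefix odd.\<close>
    have "?s = \<kappa>"
    proof (rule ccontr)
      assume "?s \<noteq> \<kappa>"
      then have less: "?s \<prec>\<^sub>u \<kappa>" using fwd[of "r + 1"] by (simp add: uni_le_def)
      obtain d where d: "first_diff d ?s \<kappa>"
        "b - x (r + 1) = ((b - x (r + 1 + int (Suc d))) + (b - (f ^^ Suc d) b)) / l ^ Suc d"
        using coded_less[OF coded_x coded_kneading[OF b_in] less] by auto
      have "(b - x (r + 1 + int (Suc d))) + (b - (f ^^ Suc d) b) = 0"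
        using d(2) l_gt_1 unfolding xb by simp
      then have "(f ^^ Suc d) b = b"
        using x_le[of "r + 1 + int (Suc d)"] funpow_in[OF b_in, of "Suc d"] by simp
      then have "(f ^^ d) b = c" using f_eq_b funpow_in[OF b_in, of d] by simp
      then have "even_word (prefix (Suc d) \<kappa>)" using even_word_kneading_return pc by blast
      then show False
        using even_word_prefix_first_diff[OF d(1)] uni_less_first_diff[OF d(1)] less by blast
    qed
    then show ?thesis using per[OF pc, of "r + 1"] by simp
  qed
  have "admissible_symbol f a b c (x r) (S r)" for r
  proof (cases "periodic_point f c")
    case True
    then show ?thesis using left(1)[of r] right(1)[of r] S_c[of r] x_ge[of r] x_le[of r]
      by (cases "S r") (auto simp: admissible_symbol_def)
  next
    case False
    then show ?thesis using left(1)[of r] right(1)[of r] x_ge[of r] x_le[of r]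
      by (simp add: admissible_symbol_def)
  qed
  moreover have "x \<in> inverse_limit f a b" using x_ge x_le f_x by (simp add: inverse_limit_def)
  ultimately show ?thesis unfolding inverse_limit_itineraries_def by blast
qed

lemma inverse_limit_itineraryD:
  assumes "S \<in> inverse_limit_itineraries f a b c"
  shows "fwd (bishift r S) \<preceq>\<^sub>u \<kappa>" "\<exists>i\<le>r. S i = 1" "\<not> ends_zeros S"
    "periodic_point f c \<Longrightarrow> fwd (bishift r S) = \<kappa> \<Longrightarrow> S (r - 1) = eps f b c"
proof -
  obtain x where x: "x \<in> inverse_limit f a b" "\<And>r. admissible_symbol f a b c (x r) (S r)"
    using assms unfolding inverse_limit_itineraries_def by blast
  note it = inverse_limit_itinerary[OF x]
  show "fwd (bishift r S) \<preceq>\<^sub>u \<kappa>" using itinerary_le_kneading it by blast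
  obtain N where N: "\<And>x s. is_itinerary f a b c x s \<Longrightarrow> x \<in> {a..b} \<Longrightarrow> \<exists>i<N. s i = 1"
    using itinerary_has_one by blast
  have one: "\<exists>i<N. S (int i + r) = 1" for r
    using N[OF it(1,2)[of r]] by (simp add: fwd_def bishift_def)
  \<comment> \<open>The window of \<open>N\<close> positions ending just before \<open>r\<close>
    contains a 1.\<close>
  obtain i where "i < N" "S (int i + (r - int N)) = 1" using one by blast
  then show "\<exists>i\<le>r. S i = 1" by (intro exI[of _ "int i + (r - int N)"]) simp
  show "\<not> ends_zeros S"
  proof
    assume "ends_zeros S"
    then obtain r0 where "\<forall>i\<ge>r0. S i = 0" unfolding ends_zeros_iff by blast
    then show False using one[of r0] by auto
  qed
  assume per: "periodic_point f c" and eq: "fwd (bishift r S) = \<kappa>"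
  have "\<bar>(f ^^ k) (x r) - (f ^^ k) b\<bar> \<le> \<bar>a\<bar> + \<bar>b\<bar>" for k
    using funpow_in[OF it(2), of k r] funpow_in[OF b_in, of k] by (simp add: abs_if split: if_splits)
  \<comment> \<open>A bounded orbit is determined by its code, and \<open>c\<close> is the only
    preimage of \<open>b\<close>.\<close>
  from coded_unique[OF _ coded_kneading[OF b_in] this] have "x r = b"
    using coded_itinerary[OF it(1,2)[of r]] eq by simp
  then have "x (r - 1) = c" using it(3)[of "r - 1"] it(2)[of "r - 1"] f_eq_b by simp
  then show "S (r - 1) = eps f b c" using x(2)[of "r - 1"] per by (simp add: admissible_symbol_def)
qed

end

theorem theorem16:
  fixes f :: "real \<Rightarrow> real" and a b c l :: real
    and \<kappa> :: "bit word" and q :: rat and m n :: nat and S :: "int \<Rightarrow> bit"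
  assumes "tent_map f a b c l"
    and "sqrt 2 < l" and "l < 2"
    and "rational_interior_type f a b c"
    and "\<kappa> = kneading f a b c"
    and "of_rat q = height \<kappa>"
    and "q = of_nat m / of_nat n" and "n > 0" and "coprime m n"
  shows "S \<in> inverse_limit_itineraries f a b c \<longleftrightarrow>
      (\<forall>r. bwd (bishift r S) \<preceq>\<^sub>u rhe q) \<and>
      (\<forall>r. suffix (n + 1) \<kappa> \<prec>\<^sub>u fwd (bishift r S) \<longrightarrow> bwd (bishift r S) \<preceq>\<^sub>u lhe q) \<and>
      \<not> ends_zeros S \<and>
      (periodic_point f c \<longrightarrow> (\<forall>r. fwd (bishift r S) = \<kappa> \<longrightarrow> S (r - 1) = eps f b c))"
proof -
  interpret T: tent f a b c l using assms(1-3) by unfold_locales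
  have "0 < real_of_rat q" "real_of_rat q < real_of_rat (1/2)"
    using T.height_kneading_pos T.height_kneading_less assms(5,6) by (simp_all add: of_rat_divide)
  then have q: "0 < q" "q < 1/2" by (simp_all add: of_rat_less)
  interpret H: height_words q using q by unfold_locales
  have n: "H.n = n" unfolding H.n_def using rat_num_den_eq(2)[OF assms(7-9)] .
  have "\<kappa> \<noteq> lhe q" "\<kappa> \<noteq> rhe q"
    using assms(4) q unfolding rational_interior_type_def assms(5)[symmetric] by simp_all
  \<comment> \<open>If this failed, \<open>height_greater\<close> would give a height above
    \<open>q\<close>. Excluding equality is the role of the interior type.\<close>
  moreover have "lhe q \<preceq>\<^sub>u \<kappa>"
    using height_greater[OF q H.has_blocks_lhe[unfolded H.lo_def H.Q_def], of \<kappa>] assms(6)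
      not_uni_le_iff by fastforce
  moreover have "\<kappa> \<preceq>\<^sub>u rhe q"
    using height_less[OF q(1) _ H.has_blocks_rhe[unfolded H.e_def H.Q_def], of \<kappa>] assms(6) q
      not_uni_le_iff by fastforce
  ultimately obtain y where y: "\<kappa> = H.c \<frown> y" "y \<prec>\<^sub>u H.p" "y = suffix (n + 1) \<kappa>"
    using H.maximal_prefix[of \<kappa>] T.suffix_kneading_le assms(5) n by metis
  show ?thesis
  proof (intro iffI conjI)
    assume S: "S \<in> inverse_limit_itineraries f a b c"
    note S = T.inverse_limit_itineraryD[OF S, folded assms(5)]
    show "\<forall>r. bwd (bishift r S) \<preceq>\<^sub>u rhe q" using H.bwd_le_rhe[OF y(1,2) S(1,2)] by blast
    show "\<forall>r. suffix (n + 1) \<kappa> \<prec>\<^sub>u fwd (bishift r S) \<longrightarrow> bwd (bishift r S) \<preceq>\<^sub>u lhe q"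
      using H.bwd_le_lhe[OF y(1,2) S(1,2)] y(3) by simp
    show "\<not> ends_zeros S" by (rule S(3))
    show "periodic_point f c \<longrightarrow> (\<forall>r. fwd (bishift r S) = \<kappa> \<longrightarrow> S (r - 1) = eps f b c)"
      using S(4) by blast
  next
    assume R: "(\<forall>r. bwd (bishift r S) \<preceq>\<^sub>u rhe q) \<and>
      (\<forall>r. suffix (n + 1) \<kappa> \<prec>\<^sub>u fwd (bishift r S) \<longrightarrow> bwd (bishift r S) \<preceq>\<^sub>u lhe q) \<and>
      \<not> ends_zeros S \<and>
      (periodic_point f c \<longrightarrow> (\<forall>r. fwd (bishift r S) = \<kappa> \<longrightarrow> S (r - 1) = eps f b c))"
    show "S \<in> inverse_limit_itineraries f a b c"
    proof (rule T.inverse_limit_itineraryI[folded assms(5)])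
      show "fwd (bishift r S) \<preceq>\<^sub>u \<kappa>" for r
        using H.fwd_le_kneading[OF y(1,2)] R y(3) by metis
      show "\<exists>i\<le>r. S i = 1" for r
        using ends_ones_if_bwd_le[OF H.has_blocks_rhe] R by blast
      show "S (r - 1) = eps f b c" if "periodic_point f c" "fwd (bishift r S) = \<kappa>" for r
        using R that by blast
    qed
  qed
qed

end
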